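(* Let $\mathcal{H}_A,\mathcal{H}_B$ be finite-dimensional Hilbert spaces and let $\rho_{A_1^nB_1^n}\in\mathcal{S}(\mathcal{H}_A^{\otimes n}\otimes\mathcal{H}_B^{\otimes n})$ be permutation invariant over the $A$-systems with respect to $B_1^n$ and over the $B$-systems with respect to $A_1^n$. Fix $m_A,m_B\le n-1$ and consider the post-measurement state obtained by measuring each of $A_2,\dots,A_{m_A+1}$ with a measurement $\mathcal{M}_A$ (POVM $\{M^A_y\}_{y\in\mathcal{Y}}$) and each of $B_2,\dots,B_{m_B+1}$ with a measurement $\mathcal{M}_B$ (POVM $\{M^B_z\}_{z\in\mathcal{Z}}$). With outcome strings $y_2^{m_A+1}\in\mathcal{Y}^{m_A}$, $z_2^{m_B+1}\in\mathcal{Z}^{m_B}$, one has $\rho_{A_1B_1}=\sum p(y_2^{m_A+1},z_2^{m_B+1})\,\rho_{A_1B_1|y_2^{m_A+1}z_2^{m_B+1}}$; set $$\tilde\rho_{A_1B_1}=\sum_{y_2^{m_A+1},z_2^{m_B+1}}p(y_2^{m_A+1},z_2^{m_B+1})\,\rho_{A_1|y_2^{m_A+1}z_2^{m_B+1}}\otimes\rho_{B_1|y_2^{m_A+1}z_2^{m_B+1}}.$$ Then: (1) There exist a probability distribution $p$ on $\mathcal{T}_{m_A}\times\mathcal{T}_{m_B}$ and states $\rho_{A_1|s,t}\in\mathcal{S}(\mathcal{H}_A)$, $\rho_{B_1|s,t}\in\mathcal{S}(\mathcal{H}_B)$ such that $$\tilde\rho_{A_1B_1}=\sum_{s\in\mathcal{T}_{m_A}}\sum_{t\in\mathcal{T}_{m_B}}p(s,t)\,\rho_{A_1|s,t}\otimes\rho_{B_1|s,t},$$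 and if $\tau_A(y_2^{m_A+1})=\tau_A({y'}_2^{m_A+1})$ then for all $z_2^{m_B+1}\in\mathcal{Z}^{m_B}$: $p(y_2^{m_A+1},z_2^{m_B+1})=p({y'}_2^{m_A+1},z_2^{m_B+1})$, $\rho_{A_1|y_2^{m_A+1}z_2^{m_B+1}}=\rho_{A_1|{y'}_2^{m_A+1}z_2^{m_B+1}}$ and $\rho_{B_1|y_2^{m_A+1}z_2^{m_B+1}}=\rho_{B_1|{y'}_2^{m_A+1}z_2^{m_B+1}}$; and similarly with the roles of $A$ and $B$ exchanged (fixed $y_2^{m_A+1}$ and $\tau_B(z_2^{m_B+1})=\tau_B({z'}_2^{m_B+1})$). (2) Define the coarse-grained POVM elements $$F^A_s:=\sum_{y_2^{m_A+1}:\,\tau_A(y_2^{m_A+1})=s}\ \bigotimes_{i=2}^{m_A+1}M^A_{y_i}\ (s\in\mathcal{T}_{m_A}),\qquad G^B_t:=\sum_{z_2^{m_B+1}:\,\tau_B(z_2^{m_B+1})=t}\ \bigotimes_{i=2}^{m_B+1}M^B_{z_i}\ (t\in\mathcal{T}_{m_B}),$$ which satisfy $\sum_sF^A_s=1$ and $\sum_tG^B_t=1$, and let $T_{m_A},T_{m_B}$ be their classical outcome registers. Then $$I(A_1:B_1|Y_2^{m_A+1}Z_2^{m_B+1})=I(A_1:B_1|T_{m_A}T_{m_B}),$$ and the same identity holds after any further local processing of $A_1$ and $B_1$; in particular, if $A_1$ and $B_1$ are measured with $\mathcal{M}_A$ and $\mathcal{M}_B$, producing $Y_1$ and $Z_1$,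 then $I(Y_1:Z_1|Y_2^{m_A+1}Z_2^{m_B+1})=I(Y_1:Z_1|T_{m_A}T_{m_B})$ for the fully measured state. (3) One has $$|\mathcal{T}_{m_A}|=\binom{m_A+|\mathcal{Y}|-1}{|\mathcal{Y}|-1}\le(m_A+1)^{|\mathcal{Y}|-1},$$ and similarly for $|\mathcal{T}_{m_B}|$ (with $|\mathcal{Z}|$). Moreover, for each $(s,t)$, $$p(s,t)=\sum_{y_2^{m_A+1}:\,\tau_A(y_2^{m_A+1})=s}\ \sum_{z_2^{m_B+1}:\,\tau_B(z_2^{m_B+1})=t}p(y_2^{m_A+1},z_2^{m_B+1})=\frac{m_A!}{\prod_{y\in\mathcal{Y}}s_y!}\cdot\frac{m_B!}{\prod_{z\in\mathcal{Z}}t_z!}\cdot p(\bar y,\bar z)$$ for any representatives $\bar y\in\mathcal{Y}^{m_A}$, $\bar z\in\mathcal{Z}^{m_B}$ with $\tau_A(\bar y)=s$, $\tau_B(\bar z)=t$.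
   Context: $S_n$ acts on $\mathcal{H}^{\otimes n}$ by permuting tensor factors, with unitaries $U(\sigma)$. A state is permutation invariant over the $B$-systems with respect to the other systems if it is invariant under conjugation by $1\otimes U_{B_1^n}(\sigma)$ for all $\sigma\in S_n$; analogously for $A$. Notation $z_k^m=(z_k,\dots,z_m)$, $B_1^n=B_1\cdots B_n$. Alphabets $\mathcal{Y},\mathcal{Z}$ are finite. $p(y,z)$ is the joint outcome probability and $\rho_{A_1B_1|y\,z}$ the state of $A_1B_1$ conditional on the outcome strings, with marginals $\rho_{A_1|yz}$, $\rho_{B_1|yz}$; statements about conditional states refer to outcomes of positive probability. Type sets: $\mathcal{T}_{m_A}=\{s\in\mathbb{N}_0^{\mathcal{Y}}:\sum_ys_y=m_A\}$ and $\mathcal{T}_{m_B}=\{t\in\mathbb{N}_0^{\mathcal{Z}}:\sum_zt_z=m_B\}$; the type maps $\tau_A:\mathcal{Y}^{m_A}\to\mathcal{T}_{m_A}$, $\tau_B:\mathcal{Z}^{m_B}\to\mathcal{T}_{m_B}$ count the occurrences of each symbol in a string. $Y_2^{m_A+1},Z_2^{m_B+1}$ are the classical registers holding the outcome strings. Conditional mutual information: $I(A:B|C)=H(A|C)+H(B|C)-H(AB|C)$ with von Neumann entropies. *)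

theory Defs
  imports
    Complex_Main
    "HOL-Library.FuncSet"
    "HOL-Library.Cardinality"
    "HOL-Library.Countable_Set"
    "HOL-Library.Complex_Order"
    "HOL-Combinatorics.Permutations"
    "Jordan_Normal_Form.Char_Poly"
begin

section \<open>Operators on finite-dimensional Hilbert spaces\<close>

text \<open>
  A finite-dimensional Hilbert space is given by a finite set \<open>I\<close> labelling an orthonormal basis,
  and an operator by its matrix in that basis. The set \<open>I\<close> is an explicit argument of the notions
  below; matrix entries outside \<open>I \<times> I\<close> are irrelevant. The basis of a tensor product is the
  Cartesian product of the bases.
\<close>

type_synonym 'i op = "'i \<Rightarrow> 'i \<Rightarrow> complex"

definition id_op :: "'i op" where
  "id_op i j = (if i = j then 1 else 0)"

definition op_mult :: "'i set \<Rightarrow> 'i op \<Rightarrow> 'i op \<Rightarrow> 'i op" where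
  "op_mult I A B = (\<lambda>i j. \<Sum>k\<in>I. A i k * B k j)"

definition op_adjoint :: "'i op \<Rightarrow> 'i op" where
  "op_adjoint A = (\<lambda>i j. cnj (A j i))"

definition tensor :: "'i op \<Rightarrow> 'j op \<Rightarrow> ('i \<times> 'j) op" where
  "tensor A B = (\<lambda>(i, j) (i', j'). A i i' * B j j')"

definition op_trace :: "'i set \<Rightarrow> 'i op \<Rightarrow> complex" where
  "op_trace I A = (\<Sum>i\<in>I. A i i)"

definition ptrace_fst :: "'i set \<Rightarrow> ('i \<times> 'j) op \<Rightarrow> 'j op" where
  "ptrace_fst I X = (\<lambda>j j'. \<Sum>i\<in>I. X (i, j) (i, j'))"

definition ptrace_snd :: "'j set \<Rightarrow> ('i \<times> 'j) op \<Rightarrow> 'i op" where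
  "ptrace_snd J X = (\<lambda>i i'. \<Sum>j\<in>J. X (i, j) (i', j))"

text \<open>
  In the order of \<^theory>\<open>HOL-Library.Complex_Order\<close>, \<open>0 \<le> z\<close> means that \<open>z\<close> is real and
  nonnegative.
\<close>

definition psd :: "'i set \<Rightarrow> 'i op \<Rightarrow> bool" where
  "psd I A \<longleftrightarrow> (\<forall>v. 0 \<le> (\<Sum>i\<in>I. \<Sum>j\<in>I. cnj (v i) * A i j * v j))"

definition state :: "'i set \<Rightarrow> 'i op \<Rightarrow> bool" where
  "state I \<rho> \<longleftrightarrow> psd I \<rho> \<and> op_trace I \<rho> = 1"

definition povm :: "'i set \<Rightarrow> 'x set \<Rightarrow> ('x \<Rightarrow> 'i op) \<Rightarrow> bool" where
  "povm I X M \<longleftrightarrow>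
     (\<forall>x\<in>X. psd I (M x)) \<and> (\<forall>i\<in>I. \<forall>j\<in>I. (\<Sum>x\<in>X. M x i j) = id_op i j)"


section \<open>Channels\<close>

text \<open>
  \<open>on_fst \<Phi>\<close> is \<open>\<Phi> \<otimes> id\<close> and \<open>on_snd \<Psi>\<close> is \<open>id \<otimes> \<Psi>\<close>: a bipartite operator is
  \<open>\<Sum>r r'. X\<^sub>r\<^sub>r' \<otimes> |r\<rangle>\<langle>r'|\<close>, and \<open>\<Phi>\<close> is applied to each block \<open>X\<^sub>r\<^sub>r'\<close>.
\<close>

definition on_fst :: "('i op \<Rightarrow> 'k op) \<Rightarrow> ('i \<times> 'j) op \<Rightarrow> ('k \<times> 'j) op" where
  "on_fst \<Phi> X = (\<lambda>(k, r) (k', r'). \<Phi> (\<lambda>i i'. X (i, r) (i', r')) k k')"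

definition on_snd :: "('j op \<Rightarrow> 'l op) \<Rightarrow> ('i \<times> 'j) op \<Rightarrow> ('i \<times> 'l) op" where
  "on_snd \<Psi> X = (\<lambda>(r, l) (r', l'). \<Psi> (\<lambda>j j'. X (r, j) (r', j')) l l')"

text \<open>Completely positive trace-preserving linear maps.\<close>

definition channel :: "(('i::finite) op \<Rightarrow> ('k::finite) op) \<Rightarrow> bool" where
  "channel \<Phi> \<longleftrightarrow>
     (\<forall>X Y. \<Phi> (\<lambda>i j. X i j + Y i j) = (\<lambda>k l. \<Phi> X k l + \<Phi> Y k l)) \<and>
     (\<forall>c X. \<Phi> (\<lambda>i j. c * X i j) = (\<lambda>k l. c * \<Phi> X k l)) \<and>
     (\<forall>d::nat. \<forall>X. psd (UNIV \<times> {..<d}) X \<longrightarrow> psd (UNIV \<times> {..<d}) (on_fst \<Phi> X)) \<and>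
     (\<forall>X. op_trace UNIV (\<Phi> X) = op_trace UNIV X)"

text \<open>Measurement of \<open>M\<close>, the outcome being recorded in a classical register.\<close>

definition meas_channel :: "('y \<Rightarrow> ('i::finite) op) \<Rightarrow> 'i op \<Rightarrow> 'y op" where
  "meas_channel M X = (\<lambda>y y'. if y = y' then op_trace UNIV (op_mult UNIV (M y) X) else 0)"


section \<open>Entropies\<close>

text \<open>
  The von Neumann entropy \<open>-Tr(\<rho> log \<rho>)\<close> is taken over the eigenvalues of \<open>\<rho>\<close>, counted with
  multiplicity, with \<open>0 log 0 = 0\<close>. The choice of the enumeration of \<open>I\<close> only conjugates the
  matrix by a permutation.
\<close>

definition op_mat :: "'i set \<Rightarrow> 'i op \<Rightarrow> complex mat" where
  "op_mat I A =
     mat (card I) (card I) (\<lambda>(k, l). A (from_nat_into I k) (from_nat_into I l))"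

definition entropy :: "'i set \<Rightarrow> 'i op \<Rightarrow> real" where
  "entropy I \<rho> = - (\<Sum>e\<in>#proots (char_poly (op_mat I \<rho>)). Re e * log 2 (Re e))"

text \<open>\<open>H(A|C) = H(AC) - H(C)\<close>.\<close>

definition cond_entropy :: "'i set \<Rightarrow> 'k set \<Rightarrow> ('i \<times> 'k) op \<Rightarrow> real" where
  "cond_entropy I K X = entropy (I \<times> K) X - entropy K (ptrace_fst I X)"

text \<open>\<open>I(A:B|C)\<close> of an operator on \<open>(A \<otimes> B) \<otimes> C\<close>.\<close>

definition cond_mutual_info ::
  "'i set \<Rightarrow> 'j set \<Rightarrow> 'k set \<Rightarrow> (('i \<times> 'j) \<times> 'k) op \<Rightarrow> real" where
  "cond_mutual_info I J K X =
     cond_entropy I K (on_fst (ptrace_snd J) X)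
     + cond_entropy J K (on_fst (ptrace_fst I) X)
     - cond_entropy (I \<times> J) K X"


section \<open>Many copies of the systems\<close>

text \<open>
  Families indexed by a set \<open>S\<close> of system labels. They serve as the basis labels of
  \<open>\<Otimes>k\<in>S. \<H>\<close> and also as the outcome strings of measurements on the systems in \<open>S\<close>.
\<close>

definition strings :: "nat set \<Rightarrow> (nat \<Rightarrow> 'x) set" where
  "strings S = S \<rightarrow>\<^sub>E UNIV"

definition joint_basis :: "nat \<Rightarrow> ((nat \<Rightarrow> 'a) \<times> (nat \<Rightarrow> 'b)) set" where
  "joint_basis n = strings {1..n} \<times> strings {1..n}"

text \<open>
  \<open>U(\<sigma>)\<close> maps the basis vector labelled \<open>j\<close> to the one labelled \<open>j \<circ> \<sigma>\<inverse>\<close>, that is, it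
  moves the content of system \<open>k\<close> to system \<open>\<sigma> k\<close>.
\<close>

definition perm_op :: "nat \<Rightarrow> (nat \<Rightarrow> nat) \<Rightarrow> (nat \<Rightarrow> 'a) op" where
  "perm_op n \<sigma> = (\<lambda>i j. if \<forall>k\<in>{1..n}. i (\<sigma> k) = j k then 1 else 0)"

definition conj_invariant :: "'i set \<Rightarrow> 'i op \<Rightarrow> 'i op \<Rightarrow> bool" where
  "conj_invariant I U \<rho> \<longleftrightarrow>
     (\<forall>i\<in>I. \<forall>j\<in>I. op_mult I (op_mult I U \<rho>) (op_adjoint U) i j = \<rho> i j)"

definition perm_invariant_A :: "nat \<Rightarrow> ((nat \<Rightarrow> 'a) \<times> (nat \<Rightarrow> 'b)) op \<Rightarrow> bool" where
  "perm_invariant_A n \<rho> \<longleftrightarrow>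
     (\<forall>\<sigma>. \<sigma> permutes {1..n} \<longrightarrow> conj_invariant (joint_basis n) (tensor (perm_op n \<sigma>) id_op) \<rho>)"

definition perm_invariant_B :: "nat \<Rightarrow> ((nat \<Rightarrow> 'a) \<times> (nat \<Rightarrow> 'b)) op \<Rightarrow> bool" where
  "perm_invariant_B n \<rho> \<longleftrightarrow>
     (\<forall>\<sigma>. \<sigma> permutes {1..n} \<longrightarrow> conj_invariant (joint_basis n) (tensor id_op (perm_op n \<sigma>)) \<rho>)"

text \<open>Reduced operator on \<open>A\<^sub>1B\<^sub>1\<close>.\<close>

definition reduced_first ::
  "nat \<Rightarrow> ((nat \<Rightarrow> 'a) \<times> (nat \<Rightarrow> 'b)) op \<Rightarrow> ('a \<times> 'b) op" where
  "reduced_first n X = (\<lambda>(a, b) (a', b').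
     \<Sum>u\<in>strings {2..n}. \<Sum>v\<in>strings {2..n}. X (u(1 := a), v(1 := b)) (u(1 := a'), v(1 := b')))"


section \<open>Measurements on the systems \<open>2, \<dots>, m + 1\<close>\<close>

definition blk :: "nat \<Rightarrow> nat set" where
  "blk m = {2..m + 1}"

text \<open>An operator on the systems in \<open>S\<close>, extended by the identity to the systems \<open>1, \<dots>, n\<close>.\<close>

definition extend_op :: "nat \<Rightarrow> nat set \<Rightarrow> (nat \<Rightarrow> 'a) op \<Rightarrow> (nat \<Rightarrow> 'a) op" where
  "extend_op n S E = (\<lambda>i j.
     if \<forall>k\<in>{1..n} - S. i k = j k then E (restrict i S) (restrict j S) else 0)"

text \<open>\<open>\<Otimes>i=2..m+1. M\<^sub>y\<^sub>i\<close>.\<close>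

definition string_povm :: "nat \<Rightarrow> ('y \<Rightarrow> 'a op) \<Rightarrow> (nat \<Rightarrow> 'y) \<Rightarrow> (nat \<Rightarrow> 'a) op" where
  "string_povm m M y = (\<lambda>i j. \<Prod>k\<in>blk m. M (y k) (i k) (j k))"

definition types :: "nat \<Rightarrow> (('y::finite) \<Rightarrow> nat) set" where
  "types m = {s. (\<Sum>y\<in>UNIV. s y) = m}"

definition type_of_string :: "nat \<Rightarrow> (nat \<Rightarrow> 'y) \<Rightarrow> 'y \<Rightarrow> nat" where
  "type_of_string m y = (\<lambda>a. card {k \<in> blk m. y k = a})"

definition strings_of_type :: "nat \<Rightarrow> ('y \<Rightarrow> nat) \<Rightarrow> (nat \<Rightarrow> 'y) set" where
  "strings_of_type m s = {y \<in> strings (blk m). type_of_string m y = s}"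

text \<open>The coarse-grained elements \<open>F\<^sub>s\<close>.\<close>

definition type_povm :: "nat \<Rightarrow> ('y \<Rightarrow> 'a op) \<Rightarrow> ('y \<Rightarrow> nat) \<Rightarrow> (nat \<Rightarrow> 'a) op" where
  "type_povm m M s = (\<lambda>i j. \<Sum>y\<in>strings_of_type m s. string_povm m M y i j)"

text \<open>
  Let \<open>P\<close> and \<open>Q\<close> be families of POVM elements on \<open>A\<^sub>2 \<dots> A\<^sub>m\<^sub>A\<^sub>+\<^sub>1\<close> and \<open>B\<^sub>2 \<dots> B\<^sub>m\<^sub>B\<^sub>+\<^sub>1\<close>. The
  subnormalised state of \<open>A\<^sub>1B\<^sub>1\<close> for the outcomes \<open>x\<close> and \<open>w\<close> is the partial trace of
  \<open>(P x \<otimes> Q w \<otimes> 1) \<rho>\<close>; its trace is the probability of these outcomes.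
\<close>

definition branch ::
  "nat \<Rightarrow> nat \<Rightarrow> nat \<Rightarrow> ('x \<Rightarrow> (nat \<Rightarrow> 'a) op) \<Rightarrow> ('w \<Rightarrow> (nat \<Rightarrow> 'b) op) \<Rightarrow>
   ((nat \<Rightarrow> 'a) \<times> (nat \<Rightarrow> 'b)) op \<Rightarrow> 'x \<Rightarrow> 'w \<Rightarrow> ('a \<times> 'b) op" where
  "branch n mA mB P Q \<rho> x w = reduced_first n
     (op_mult (joint_basis n)
        (tensor (extend_op n (blk mA) (P x)) (extend_op n (blk mB) (Q w))) \<rho>)"

definition outcome_prob ::
  "nat \<Rightarrow> nat \<Rightarrow> nat \<Rightarrow> ('x \<Rightarrow> (nat \<Rightarrow> 'a::finite) op) \<Rightarrow> ('w \<Rightarrow> (nat \<Rightarrow> 'b::finite) op) \<Rightarrow>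
   ((nat \<Rightarrow> 'a) \<times> (nat \<Rightarrow> 'b)) op \<Rightarrow> 'x \<Rightarrow> 'w \<Rightarrow> real" where
  "outcome_prob n mA mB P Q \<rho> x w = Re (op_trace UNIV (branch n mA mB P Q \<rho> x w))"

text \<open>Only meaningful for outcomes of positive probability; the zero operator otherwise.\<close>

definition cond_state ::
  "nat \<Rightarrow> nat \<Rightarrow> nat \<Rightarrow> ('x \<Rightarrow> (nat \<Rightarrow> 'a::finite) op) \<Rightarrow> ('w \<Rightarrow> (nat \<Rightarrow> 'b::finite) op) \<Rightarrow>
   ((nat \<Rightarrow> 'a) \<times> (nat \<Rightarrow> 'b)) op \<Rightarrow> 'x \<Rightarrow> 'w \<Rightarrow> ('a \<times> 'b) op" where
  "cond_state n mA mB P Q \<rho> x w =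
     (\<lambda>i j. branch n mA mB P Q \<rho> x w i j / of_real (outcome_prob n mA mB P Q \<rho> x w))"

text \<open>
  Post-measurement state of \<open>A\<^sub>1B\<^sub>1\<close> together with the classical registers holding the outcomes,
  \<open>\<Sum>x w. p(x,w) \<rho>\<^sub>|\<^sub>x\<^sub>w \<otimes> |x w\<rangle>\<langle>x w|\<close>.
\<close>

definition post_meas_state ::
  "nat \<Rightarrow> nat \<Rightarrow> nat \<Rightarrow> ('x \<Rightarrow> (nat \<Rightarrow> 'a) op) \<Rightarrow> ('w \<Rightarrow> (nat \<Rightarrow> 'b) op) \<Rightarrow>
   ((nat \<Rightarrow> 'a) \<times> (nat \<Rightarrow> 'b)) op \<Rightarrow> (('a \<times> 'b) \<times> ('x \<times> 'w)) op" where
  "post_meas_state n mA mB P Q \<rho> = (\<lambda>(i, (x, w)) (j, (x', w')).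
     if x = x' \<and> w = w' then branch n mA mB P Q \<rho> x w i j else 0)"

text \<open>\<open>(\<Phi> \<otimes> \<Psi>) \<otimes> id\<close> on \<open>(A \<otimes> B) \<otimes> C\<close>.\<close>

definition local_processing ::
  "('a op \<Rightarrow> 'c op) \<Rightarrow> ('b op \<Rightarrow> 'd op) \<Rightarrow> (('a \<times> 'b) \<times> 'k) op \<Rightarrow> (('c \<times> 'd) \<times> 'k) op" where
  "local_processing \<Phi> \<Psi> = on_fst (on_snd \<Psi> \<circ> on_fst \<Phi>)"

end

theory Submission
  imports Defs "Jordan_Normal_Form.Schur_Decomposition" "HOL-Combinatorics.Multiset_Permutations"
begin

text \<open>
  Permuting the measured systems permutes the outcome string without changing the subnormalised
  state of \<open>A\<^sub>1B\<^sub>1\<close>. This state therefore depends on the strings only through their types, and the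
  state for a pair of types is the state for any representatives, multiplied by the number of
  strings of these types. For a classical conditioning system the conditional mutual information
  is the sum over the outcomes of a function of the subnormalised state that is homogeneous of
  degree one, so that merging proportional states leaves the sum unchanged; a linear local
  processing preserves the proportionality.
\<close>

section \<open>Positive semidefinite kernels\<close>

text \<open>In \<open>branch\<close> the outcome operators multiply \<open>\<rho>\<close> from one
  side only, so positivity of the result cannot be read off. It is needed three times: for
  nonnegative probabilities, for the normalised branches to be states, and for a branch of trace
  zero to vanish. The kernel calculus below derives it without operator square roots, from the
  nonnegativity of Tr (T \<rho>) for positive kernels.

  Only permutations supported on the measured blocks are used. They fix system 1, hence leave the
  basis labels of A_1 B_1 alone, and merely rearrange the systems that are traced out.

  Entropies are defined from roots of the characteristic polynomial for one particular enumeration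
  of the basis. Splitting them over the values of a classical register therefore requires
  independence of the enumeration, and scaling them requires a triangular form on whose diagonal the
  eigenvalues stand.\<close>

lemma psdD: "psd I A \<Longrightarrow> 0 \<le> (\<Sum>i\<in>I. \<Sum>j\<in>I. cnj (v i) * A i j * v j)"
  by (simp add: psd_def)

lemma psd_cong:
  assumes "\<And>i j. i \<in> I \<Longrightarrow> j \<in> I \<Longrightarrow> A i j = B i j"
  shows "psd I A \<longleftrightarrow> psd I B"
  using assms by (simp add: psd_def cong: sum.cong)

lemma cnj_mult_nonneg: "0 \<le> cnj z * (z::complex)"
  by (simp add: less_eq_complex_def)

lemma psd_rank_one: "psd I (\<lambda>i j. w i * cnj (w j))"
  unfolding psd_def
proof
  fix v
  have "(\<Sum>i\<in>I. \<Sum>j\<in>I. cnj (v i) * (w i * cnj (w j)) * v j)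
      = (\<Sum>i\<in>I. cnj (v i) * w i) * (\<Sum>i\<in>I. cnj (w i) * v i)"
    unfolding sum_product by (simp add: mult_ac)
  also have "(\<Sum>i\<in>I. cnj (v i) * w i) = cnj (\<Sum>i\<in>I. cnj (w i) * v i)"
    by (simp add: mult.commute)
  finally have "(\<Sum>i\<in>I. \<Sum>j\<in>I. cnj (v i) * (w i * cnj (w j)) * v j)
      = cnj (\<Sum>i\<in>I. cnj (w i) * v i) * (\<Sum>i\<in>I. cnj (w i) * v i)" .
  then show "0 \<le> (\<Sum>i\<in>I. \<Sum>j\<in>I. cnj (v i) * (w i * cnj (w j)) * v j)"
    by (simp only: cnj_mult_nonneg)
qed

lemma psd_sum:
  assumes "\<And>r. r \<in> R \<Longrightarrow> psd I (A r)"
  shows "psd I (\<lambda>i j. \<Sum>r\<in>R. A r i j)"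
  unfolding psd_def
proof
  fix v
  have "(\<Sum>i\<in>I. \<Sum>j\<in>I. cnj (v i) * (\<Sum>r\<in>R. A r i j) * v j)
      = (\<Sum>r\<in>R. \<Sum>i\<in>I. \<Sum>j\<in>I. cnj (v i) * A r i j * v j)"
    by (subst sum.swap, rule sum.cong[OF refl], subst sum.swap)
       (simp add: sum_distrib_left sum_distrib_right)
  also have "0 \<le> \<dots>" using assms by (intro sum_nonneg psdD) auto
  finally show "0 \<le> (\<Sum>i\<in>I. \<Sum>j\<in>I. cnj (v i) * (\<Sum>r\<in>R. A r i j) * v j)" .
qed

lemma psd_swap:
  assumes "psd I A" shows "psd I (\<lambda>i j. A j i)"
  unfolding psd_def
proof
  fix v
  have "(\<Sum>i\<in>I. \<Sum>j\<in>I. cnj (v i) * A j i * v j)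
      = (\<Sum>i\<in>I. \<Sum>j\<in>I. cnj (cnj (v i)) * A i j * cnj (v j))"
    by (subst sum.swap) (simp add: mult_ac)
  also have "0 \<le> \<dots>" using psdD[OF assms, of "\<lambda>i. cnj (v i)"] .
  finally show "0 \<le> (\<Sum>i\<in>I. \<Sum>j\<in>I. cnj (v i) * A j i * v j)" .
qed

lemma psd_diag_congruence:
  assumes "psd I A"
  shows "psd I (\<lambda>i j. w i * A i j * cnj (w j))"
  unfolding psd_def
proof
  fix v
  have "0 \<le> (\<Sum>i\<in>I. \<Sum>j\<in>I. cnj (cnj (w i) * v i) * A i j * (cnj (w j) * v j))"
    by (rule psdD[OF assms])
  then show "0 \<le> (\<Sum>i\<in>I. \<Sum>j\<in>I. cnj (v i) * (w i * A i j * cnj (w j)) * v j)"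
    by (simp add: mult_ac)
qed

lemma psd_subset:
  fixes I :: "'i set"
  assumes "psd I A" "J \<subseteq> I" "finite I"
  shows "psd J A"
  unfolding psd_def
proof
  fix v :: "'i \<Rightarrow> complex"
  let ?v = "\<lambda>i. if i \<in> J then v i else 0"
  have "(\<Sum>i\<in>I. \<Sum>j\<in>I. cnj (?v i) * A i j * ?v j) = (\<Sum>i\<in>J. \<Sum>j\<in>J. cnj (v i) * A i j * v j)"
  proof -
    have "(\<Sum>i\<in>I. \<Sum>j\<in>I. cnj (?v i) * A i j * ?v j) = (\<Sum>i\<in>J. \<Sum>j\<in>I. cnj (?v i) * A i j * ?v j)"
      using assms by (intro sum.mono_neutral_right) auto
    also have "\<dots> = (\<Sum>i\<in>J. \<Sum>j\<in>J. cnj (?v i) * A i j * ?v j)"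
      using assms by (intro sum.cong[OF refl] sum.mono_neutral_right) auto
    finally show ?thesis by simp
  qed
  then show "0 \<le> (\<Sum>i\<in>J. \<Sum>j\<in>J. cnj (v i) * A i j * v j)"
    using psdD[OF assms(1), of ?v] by simp
qed

text \<open>The form of the pullback at \<open>v\<close> is the form of \<open>A\<close> at the
  push-forward of \<open>v\<close>, which sums \<open>v\<close> over the fibres of \<open>f\<close>.
  With \<open>f\<close> a projection of labels, this lifts kernels on few systems to kernels on
  many.\<close>

lemma psd_pullback:
  fixes I :: "'i set" and J :: "'j set"
  assumes A: "psd J A" and f: "\<And>i. i \<in> I \<Longrightarrow> f i \<in> J" and fin: "finite I" "finite J"
  shows "psd I (\<lambda>i j. A (f i) (f j))"
  unfolding psd_def
proof
  fix v :: "'i \<Rightarrow> complex"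
  let ?v = "\<lambda>c. \<Sum>i\<in>{i\<in>I. f i = c}. v i"
  have group: "(\<Sum>c\<in>J. \<Sum>i\<in>{i\<in>I. f i = c}. h i) = (\<Sum>i\<in>I. h i)" for h :: "'i \<Rightarrow> complex"
    by (rule sum.group[OF fin]) (use f in auto)
  have "(\<Sum>c\<in>J. \<Sum>d\<in>J. cnj (?v c) * A c d * ?v d)
      = (\<Sum>c\<in>J. \<Sum>d\<in>J. \<Sum>i\<in>{i\<in>I. f i = c}. \<Sum>j\<in>{j\<in>I. f j = d}. cnj (v i) * A (f i) (f j) * v j)"
    unfolding cnj_sum sum_distrib_right[of _ _ "A _ _"] sum_product by simp
  also have "\<dots> = (\<Sum>c\<in>J. \<Sum>i\<in>{i\<in>I. f i = c}. \<Sum>d\<in>J. \<Sum>j\<in>{j\<in>I. f j = d}. cnj (v i) * A (f i) (f j) * v j)"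
    by (intro sum.cong refl sum.swap)
  also have "\<dots> = (\<Sum>i\<in>I. \<Sum>j\<in>I. cnj (v i) * A (f i) (f j) * v j)"
    by (simp only: group)
  finally show "0 \<le> (\<Sum>i\<in>I. \<Sum>j\<in>I. cnj (v i) * A (f i) (f j) * v j)"
    using psdD[OF A, of ?v] by simp
qed

section \<open>Entries of positive semidefinite kernels\<close>

lemma psd_diag:
  assumes "psd I A" "finite I" "x \<in> I"
  shows "0 \<le> A x x"
proof -
  have "psd {x} A" by (rule psd_subset[OF assms(1) _ assms(2)]) (use assms in auto)
  from psdD[OF this, of "\<lambda>_. 1"] show ?thesis by simp
qed

lemma psd_herm:
  assumes "psd I A" "finite I" "x \<in> I" "y \<in> I"
  shows "A y x = cnj (A x y)"
proof (cases "x = y")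
  case True
  then show ?thesis using psd_diag[OF assms(1,2,3)] by (simp add: less_eq_complex_def complex_eq_iff)
next
  case False
  have d: "Im (A x x) = 0" "Im (A y y) = 0"
    using psd_diag[OF assms(1,2)] assms(3,4) by (simp_all add: less_eq_complex_def)
  have p: "psd {x,y} A" by (rule psd_subset[OF assms(1) _ assms(2)]) (use assms in auto)
  \<comment> \<open>The test vectors (1, 1) and (1, i) isolate the imaginary and the real parts of
    the two off-diagonal entries.\<close>
  from psdD[OF p, of "\<lambda>_. 1"] have 1: "Im (A x y) + Im (A y x) = 0"
    using False d by (auto simp: less_eq_complex_def)
  from psdD[OF p, of "\<lambda>i. if i = x then 1 else \<i>"] have 2: "Re (A x y) - Re (A y x) = 0"
    using False d by (auto simp: less_eq_complex_def)
  show ?thesis using 1 2 by (simp add: complex_eq_iff)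
qed

lemma psd_zero_diag:
  assumes "psd I A" "finite I" "x \<in> I" "y \<in> I" "A x x = 0"
  shows "A x y = 0"
proof (cases "x = y")
  case False
  have p: "psd {x,y} A" by (rule psd_subset[OF assms(1) _ assms(2)]) (use assms in auto)
  have h: "A y x = cnj (A x y)" by (rule psd_herm[OF assms(1-4)])
  define c d where "c = (cmod (A x y))\<^sup>2" and "d = Re (A y y)"
  have d: "A y y = of_real d" "0 \<le> d" using psd_diag[OF assms(1,2,4)]
    by (simp_all add: less_eq_complex_def complex_eq_iff d_def)
  have c: "cnj (A x y) * A x y = of_real c" "A x y * cnj (A x y) = of_real c"
    by (simp_all add: c_def complex_norm_square mult.commute del: of_real_power)
  \<comment> \<open>On the test vectors (-t \<open>A x y\<close>, 1) the form is affine in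
    \<open>t\<close>, because the quadratic term carries the vanishing entry
    \<open>A x x\<close>.\<close>
  have "0 \<le> - 2 * t * c + d" for t :: real
  proof -
    have "0 \<le> (\<Sum>i\<in>{x,y}. \<Sum>j\<in>{x,y}. cnj ((\<lambda>i. if i = x then - of_real t * A x y else 1) i) * A i j
       * (\<lambda>i. if i = x then - of_real t * A x y else 1) j)" by (rule psdD[OF p])
    also have "\<dots> = of_real (- 2 * t * c + d)"
      using False assms(5) by (simp add: h d c algebra_simps flip: c)
    finally show ?thesis by (simp add: less_eq_complex_def)
  qed
  \<comment> \<open>If \<open>c\<close> were nonzero, this \<open>t\<close> would give the value
    -1.\<close>
  from this[of "(d+1)/ (2*c)"] have "c = 0" by (cases "c = 0") (simp_all add: field_simps)
  then show ?thesis by (simp add: c_def)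
qed (use assms in simp)

text \<open>Cholesky decomposition; in the induction step the Schur complement of the pivot
  \<open>A x x\<close> is again positive semidefinite. For a zero pivot the junk value \<open>z / 0 = 0\<close> is
  harmless, since then the whole row vanishes.\<close>

lemma psd_decomposition:
  assumes "finite I" "psd I A"
  shows "\<exists>w. \<forall>i\<in>I. \<forall>j\<in>I. A i j = (\<Sum>r\<in>I. w r i * cnj (w r j))"
  using assms
proof (induction I arbitrary: A rule: finite_induct)
  case empty
  then show ?case by simp
next
  case (insert x F)
  let ?I = "insert x F"
  have finI: "finite ?I" using insert by simp
  note psd = insert.prems
  define d where "d = Re (A x x)"
  have d: "A x x = of_real d" "0 \<le> d" using psd_diag[OF psd finI]
    by (simp_all add: less_eq_complex_def complex_eq_iff d_def)
  have herm: "A j i = cnj (A i j)" if "i \<in> ?I" "j \<in> ?I" for i j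
    using psd_herm[OF psd finI that] .
  have zero: "A x j = 0" if "d = 0" "j \<in> ?I" for j
    using psd_zero_diag[OF psd finI _ that(2), of x] that d by simp
  define B where "B i j = A i j - A i x * A x j / of_real d" for i j
  have "psd F B"
    unfolding psd_def
  proof
    fix v
    define s where "s = (\<Sum>j\<in>F. A x j * v j)"
    \<comment> \<open>The value at \<open>x\<close> is chosen so that row \<open>x\<close> of
      \<open>A\<close> annihilates \<open>v'\<close>. The form of \<open>A\<close> at
      \<open>v'\<close> then equals the form of the Schur complement \<open>B\<close> at
      \<open>v\<close>.\<close>
    define v' where "v' i = (if i = x then - s / of_real d else v i)" for i
    have v'F: "v' i = v i" if "i \<in> F" for i using that insert.hyps by (auto simp: v'_def)
    have s0: "s = 0" if "d = 0" using zero[OF that] by (simp add: s_def)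
    have cs: "cnj s = (\<Sum>i\<in>F. cnj (v i) * A i x)"
      unfolding s_def cnj_sum by (intro sum.cong refl) (simp add: herm[of x])
    have row: "(\<Sum>j\<in>?I. A x j * v' j) = 0"
      using insert.hyps d s0 v'F by (cases "d = 0") (simp_all add: v'_def[of x] flip: s_def)
    have "(\<Sum>i\<in>?I. \<Sum>j\<in>?I. cnj (v' i) * A i j * v' j)
        = (\<Sum>i\<in>F. \<Sum>j\<in>?I. cnj (v' i) * A i j * v' j)"
      using row insert.hyps by (simp add: mult.assoc flip: sum_distrib_left distrib_left)
    also have "\<dots> = (\<Sum>i\<in>F. cnj (v i) * A i x * (- s / of_real d)) + (\<Sum>i\<in>F. \<Sum>j\<in>F. cnj (v i) * A i j * v j)"
      using insert.hyps v'F by (simp add: sum_subtractf sum_negf v'_def[of x])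
    also have "(\<Sum>i\<in>F. cnj (v i) * A i x * (- s / of_real d)) = - (cnj s * s / of_real d)"
      unfolding cs by (simp add: sum_distrib_right sum_divide_distrib sum_negf)
    also have "cnj s * s / of_real d = (\<Sum>i\<in>F. \<Sum>j\<in>F. cnj (v i) * (A i x * A x j / of_real d) * v j)"
      unfolding cs unfolding s_def sum_product sum_divide_distrib by (simp add: mult_ac)
    finally have "(\<Sum>i\<in>?I. \<Sum>j\<in>?I. cnj (v' i) * A i j * v' j) = (\<Sum>i\<in>F. \<Sum>j\<in>F. cnj (v i) * B i j * v j)"
      by (simp add: B_def algebra_simps sum_subtractf)
    with psdD[OF psd, of v'] show "0 \<le> (\<Sum>i\<in>F. \<Sum>j\<in>F. cnj (v i) * B i j * v j)" by simp
  qed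
  from insert.IH[OF this] obtain w where w: "\<And>i j. i \<in> F \<Longrightarrow> j \<in> F \<Longrightarrow> B i j = (\<Sum>r\<in>F. w r i * cnj (w r j))"
    by blast
  \<comment> \<open>Vector \<open>x\<close> is the pivot column divided by the root of the pivot;
    the others factor the Schur complement and are extended by zero at \<open>x\<close>.\<close>
  define w' where "w' r i = (if r = x then A i x / of_real (sqrt d) else if i = x then 0 else w r i)" for r i
  have dd: "complex_of_real (sqrt d) * complex_of_real (sqrt d) = of_real d"
    using d(2) by (simp flip: of_real_mult)
  have "A i j = (\<Sum>r\<in>?I. w' r i * cnj (w' r j))" if ij: "i \<in> ?I" "j \<in> ?I" for i j
  proof -
    have "(\<Sum>r\<in>?I. w' r i * cnj (w' r j)) = A i x * A x j / of_real d + (\<Sum>r\<in>F. w' r i * cnj (w' r j))"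
      using insert.hyps ij by (simp add: w'_def dd herm[of x j])
    also have "(\<Sum>r\<in>F. w' r i * cnj (w' r j)) = (if i = x \<or> j = x then 0 else \<Sum>r\<in>F. w r i * cnj (w r j))"
      using insert.hyps by (auto simp: w'_def intro!: sum.cong sum.neutral)
    also have "A i x * A x j / of_real d + \<dots> = A i j"
      using ij d zero[of i] zero[of j] herm[of x i]
      by (cases "d = 0") (auto simp: B_def simp flip: w)
    finally show ?thesis by simp
  qed
  then show ?case by blast
qed

text \<open>Schur product theorem: expanding one factor into rank-one kernels turns the entrywise
  product into a sum of diagonal congruences of the other factor.\<close>

lemma psd_schur_product:
  assumes "finite I" "psd I A" "psd I B"
  shows "psd I (\<lambda>i j. A i j * B i j)"
proof -
  obtain w where w: "\<And>i j. i \<in> I \<Longrightarrow> j \<in> I \<Longrightarrow> A i j = (\<Sum>r\<in>I. w r i * cnj (w r j))"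
    using psd_decomposition[OF assms(1,2)] by blast
  have "psd I (\<lambda>i j. \<Sum>r\<in>I. w r i * B i j * cnj (w r j))"
    by (intro psd_sum psd_diag_congruence assms)
  then show ?thesis
    by (rule psd_cong[THEN iffD1, rotated]) (simp add: w sum_distrib_right sum_distrib_left mult_ac)
qed

lemma psd_one: "psd I (\<lambda>i j. 1)"
  using psd_rank_one[of I "\<lambda>_. 1"] by simp

lemma psd_schur_prod:
  assumes "finite I" "\<And>k. k \<in> S \<Longrightarrow> psd I (A k)"
  shows "psd I (\<lambda>i j. \<Prod>k\<in>S. A k i j)"
  using assms(2)
  by (induction S rule: infinite_finite_induct) (auto intro: psd_one psd_schur_product assms(1))

text \<open>The kernel is the sum of the rank-one kernels of the indicators of the fibres of
  \<open>g\<close>. It represents the identity on the systems that \<open>g\<close> reads.\<close>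

lemma psd_indicator_eq:
  assumes "finite I"
  shows "psd I (\<lambda>i j. if g i = g j then 1 else 0)"
proof -
  have "psd I (\<lambda>i j. \<Sum>c\<in>g`I. (if g i = c then 1 else 0) * cnj (if g j = c then 1 else 0))"
    by (intro psd_sum psd_rank_one)
  then show ?thesis
    by (rule psd_cong[THEN iffD1, rotated])
      (auto simp: assms sum.delta' if_distrib[of cnj] if_distrib[of "\<lambda>x. x * _"] intro!: sum.neutral cong: if_cong)
qed

text \<open>Tr (A B) is the form of the entrywise product of \<open>A\<close> with the transpose of
  \<open>B\<close>, taken at the all-ones vector.\<close>

lemma psd_trace_product_nonneg:
  assumes "finite I" "psd I A" "psd I B"
  shows "0 \<le> (\<Sum>i\<in>I. \<Sum>j\<in>I. A i j * B j i)"
  using psdD[OF psd_schur_product[OF assms(1,2) psd_swap[OF assms(3)]], of "\<lambda>_. 1"] by simp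

lemma psd_op_trace_nonneg: "finite I \<Longrightarrow> psd I A \<Longrightarrow> 0 \<le> op_trace I A"
  unfolding op_trace_def by (intro sum_nonneg psd_diag)

text \<open>Nonnegative diagonal entries with sum zero all vanish, and each takes its row with it.
  This is what makes branches of probability zero vanish.\<close>

lemma psd_trace_zero:
  assumes "finite I" "psd I A" "op_trace I A = 0" "i \<in> I" "j \<in> I"
  shows "A i j = 0"
proof -
  have "(\<Sum>i\<in>I. A i i) = 0" using assms(3) by (simp add: op_trace_def)
  then have "A i i = 0"
    using sum_nonneg_eq_0_iff[OF assms(1), of "\<lambda>i. A i i"] psd_diag[OF assms(2,1)] assms(4) by blast
  then show ?thesis using psd_zero_diag[OF assms(2,1,4,5)] by blast
qed

section \<open>Types of strings\<close>

lemma finite_blk [simp]: "finite (blk m)" and card_blk: "card (blk m) = m"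
  by (simp_all add: blk_def)

lemma finite_strings [simp]: "finite S \<Longrightarrow> finite (strings S :: (nat \<Rightarrow> 'x::finite) set)"
  by (simp add: strings_def finite_PiE)

text \<open>Stars and bars: along an enumeration of the alphabet, types become lists of length
  \<open>CARD('y)\<close> with sum \<open>m\<close>.\<close>

lemma card_types:
  "card (types m :: ('y::finite \<Rightarrow> nat) set) = (m + CARD('y) - 1) choose (CARD('y) - 1)"
proof -
  obtain xs where xs: "set xs = (UNIV :: 'y set)" "distinct xs"
    using finite_distinct_list[of "UNIV :: 'y set"] by auto
  have len: "length xs = CARD('y)" using distinct_card[OF xs(2)] xs(1) by simp
  have "bij_betw (\<lambda>s. map s xs) (types m) {l. length l = CARD('y) \<and> sum_list l = m}"
  proof (rule bij_betwI')
    fix s t :: "'y \<Rightarrow> nat" assume "s \<in> types m" "t \<in> types m"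
    show "(map s xs = map t xs) = (s = t)" using xs by (auto simp: fun_eq_iff)
  next
    fix s :: "'y \<Rightarrow> nat" assume "s \<in> types m"
    then show "map s xs \<in> {l. length l = CARD('y) \<and> sum_list l = m}"
      using xs len by (simp add: types_def sum_list_distinct_conv_sum_set)
  next
    fix l assume l: "l \<in> {l. length l = CARD('y) \<and> sum_list l = m}"
    let ?s = "\<lambda>y. the (map_of (zip xs l) y)"
    have "map ?s xs = l"
      using l len xs(2) by (intro nth_equalityI) (auto simp: map_of_zip_nth)
    moreover from this have "?s \<in> types m"
      using l xs(1) sum_list_distinct_conv_sum_set[OF xs(2), of ?s] by (simp add: types_def)
    ultimately show "\<exists>s\<in>types m. l = map s xs" by metis
  qed
  then have "card (types m :: ('y \<Rightarrow> nat) set) = (m + CARD('y) - 1) choose m"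
    by (simp add: bij_betw_same_card card_length_sum_list)
  also have "\<dots> = (m + CARD('y) - 1) choose (CARD('y) - 1)"
  proof -
    have "0 < CARD('y)" by simp
    then have "m \<le> m + CARD('y) - 1" "m + CARD('y) - 1 - m = CARD('y) - 1" by linarith+
    then show ?thesis by (metis binomial_symmetric)
  qed
  finally show ?thesis .
qed

text \<open>The binomial coefficient is positive whereas infinite sets have cardinality zero, so the
  count itself yields finiteness.\<close>

lemma finite_types [simp]: "finite (types m :: ('y::finite \<Rightarrow> nat) set)"
proof -
  have "0 < card (types m :: ('y \<Rightarrow> nat) set)"
    unfolding card_types by (simp add: zero_less_binomial_iff)
  then show ?thesis by (rule card_ge_0_finite)
qed

text \<open>Induction by absorption: passing from \<open>k\<close> to \<open>Suc k\<close>
  multiplies the coefficient by (m + k + 1) / (k + 1), which is at most m + 1.\<close>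

lemma binomial_le_power_Suc: "(m + k) choose k \<le> (m + 1) ^ k"
proof (induction k)
  case (Suc k)
  have "Suc k * (Suc (m + k) choose Suc k) = Suc (m + k) * (m + k choose k)"
    by (rule Suc_times_binomial)
  also have "\<dots> \<le> (Suc k * (m + 1)) * (m + 1) ^ k"
    by (intro mult_mono Suc) auto
  finally show ?case by (simp del: binomial_Suc_Suc mult_Suc mult_Suc_right add: mult.assoc)
qed simp

lemma card_types_le: "card (types m :: ('y::finite \<Rightarrow> nat) set) \<le> (m + 1) ^ (CARD('y) - 1)"
proof -
  have "0 < CARD('y)" by simp
  then have "m + CARD('y) - 1 = m + (CARD('y) - 1)" by linarith
  then show ?thesis using binomial_le_power_Suc[of m "CARD('y) - 1"] by (simp only: card_types)
qed

text \<open>A type is the count function of the multiset of symbols. Both the number of strings of a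
  type and the permutations between them thereby become facts about multisets.\<close>

lemma count_image_mset_blk: "count (image_mset y (mset_set (blk m))) = type_of_string m y"
  by (simp add: fun_eq_iff type_of_string_def count_image_mset_eq_card_vimage)

lemma type_of_string_in_types: "type_of_string m y \<in> types m"
proof -
  have "(\<Sum>a\<in>UNIV. card {k \<in> blk m. y k = a}) = (\<Sum>a\<in>UNIV. \<Sum>k\<in>{k \<in> blk m. y k = a}. 1)"
    by simp
  also have "\<dots> = (\<Sum>k\<in>blk m. 1)" by (rule sum.group) auto
  finally show ?thesis by (simp add: types_def type_of_string_def card_blk)
qed

lemma finite_strings_of_type [simp]:
  "finite (strings_of_type m s :: (nat \<Rightarrow> 'y::finite) set)"
  by (simp add: strings_of_type_def)

lemma sum_strings_by_type:
  "(\<Sum>s\<in>types m. \<Sum>y\<in>strings_of_type m s. h y) = (\<Sum>y\<in>strings (blk m). h (y :: nat \<Rightarrow> 'y::finite))"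
  unfolding strings_of_type_def by (rule sum.group) (auto intro: type_of_string_in_types)

text \<open>Read as lists along the block, the strings of type \<open>s\<close> are the arrangements
  of the multiset with count function \<open>s\<close>. The product form expresses the multinomial
  coefficient without division in \<open>nat\<close>.\<close>

lemma card_strings_of_type:
  assumes "s \<in> types m"
  shows "card (strings_of_type m s) * (\<Prod>a\<in>UNIV. fact (s a)) = (fact m :: nat)"
proof -
  define A where "A = Abs_multiset s"
  have cA: "count A = s" by (simp add: A_def count_Abs_multiset)
  have szA: "size A = m"
  proof -
    have "size A = (\<Sum>a\<in>UNIV. count A a)"
      unfolding size_multiset_overloaded_eq
      by (rule sum.mono_neutral_left) (auto simp: count_eq_zero_iff)
    then show ?thesis using assms by (simp add: cA types_def)
  qed
  have ms: "mset (map y [2..<m+2]) = image_mset y (mset_set (blk m))" for y :: "nat \<Rightarrow> 'a"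
  proof -
    have "{2..<m+2} = blk m" by (auto simp: blk_def)
    then show ?thesis by (simp only: mset_map mset_upt)
  qed
  have "bij_betw (\<lambda>y. map y [2..<m+2]) (strings_of_type m s) (permutations_of_multiset A)"
  proof (rule bij_betwI')
    fix y y' :: "nat \<Rightarrow> 'a" assume yy: "y \<in> strings_of_type m s" "y' \<in> strings_of_type m s"
    show "(map y [2..<m+2] = map y' [2..<m+2]) = (y = y')"
    proof
      assume "map y [2..<m+2] = map y' [2..<m+2]"
      then have "y k = y' k" if "k \<in> blk m" for k
        using that by (simp add: blk_def del: upt_Suc)
      with yy show "y = y'"
        unfolding strings_of_type_def strings_def by (auto intro: PiE_ext)
    qed simp
  next
    fix y :: "nat \<Rightarrow> 'a" assume "y \<in> strings_of_type m s"
    then show "map y [2..<m+2] \<in> permutations_of_multiset A"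
      unfolding permutations_of_multiset_def mem_Collect_eq ms multiset_eq_iff
      by (simp add: strings_of_type_def cA count_image_mset_blk)
  next
    fix xs assume xs: "xs \<in> permutations_of_multiset A"
    then have len: "length xs = m" using szA by (metis length_finite_permutations_of_multiset)
    \<comment> \<open>List position 0 belongs to system 2. The value \<open>undefined\<close> off
      the block is forced by the extensionality of strings.\<close>
    define y where "y k = (if k \<in> blk m then xs ! (k - 2) else undefined)" for k
    have m: "map y [2..<m+2] = xs"
      using len by (intro nth_equalityI) (auto simp: y_def blk_def simp del: upt_Suc)
    have "type_of_string m y = count (mset xs)"
      unfolding count_image_mset_blk[symmetric] ms[symmetric] m ..
    then have "y \<in> strings_of_type m s"
      using xs by (auto simp: strings_of_type_def strings_def y_def permutations_of_multiset_def cA)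
    then show "\<exists>y\<in>strings_of_type m s. xs = map y [2..<m+2]" using m by blast
  qed
  then have "card (strings_of_type m s) = card (permutations_of_multiset A)"
    by (rule bij_betw_same_card)
  moreover have "(\<Prod>a\<in>set_mset A. fact (count A a)) = (\<Prod>a\<in>UNIV. fact (s a) :: nat)"
    unfolding cA[symmetric]
    by (rule prod.mono_neutral_left) (auto simp: not_in_iff)
  ultimately show ?thesis using card_permutations_of_multiset_aux[of A] szA by simp
qed

lemma real_card_strings_of_type:
  assumes "s \<in> types m"
  shows "real (card (strings_of_type m s)) = fact m / (\<Prod>a\<in>UNIV. fact (s a))"
  using arg_cong[OF card_strings_of_type[OF assms], of real]
  by (simp add: eq_divide_eq)

lemma card_strings_of_type_pos:
  assumes "s \<in> types m"
  shows "0 < card (strings_of_type m s)"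
  using card_strings_of_type[OF assms] by (cases "card (strings_of_type m s)") auto

text \<open>Permutations of the block act transitively on the strings of one type. Off the block
  \<open>\<sigma>\<close> is the identity and both strings are \<open>undefined\<close>, which gives
  an equality of whole functions.\<close>

lemma same_type_permutation:
  assumes y: "y \<in> strings (blk m)" "y' \<in> strings (blk m)"
    and t: "type_of_string m y = type_of_string m y'"
  obtains \<sigma> where "\<sigma> permutes blk m" "y' = y \<circ> \<sigma>"
proof -
  have "image_mset y' (mset_set (blk m)) = image_mset y (mset_set (blk m))"
    using t by (simp add: multiset_eq_iff count_image_mset_blk)
  from image_mset_eq_implies_permutes[OF finite_blk this]
  obtain \<sigma> where \<sigma>: "\<sigma> permutes blk m" "\<forall>k\<in>blk m. y' k = y (\<sigma> k)" by blast
  have "y' k = (y \<circ> \<sigma>) k" for k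
    using \<sigma> y by (cases "k \<in> blk m") (auto simp: strings_def PiE_def extensional_def permutes_not_in)
  with \<sigma> show thesis using that by blast
qed

section \<open>Post-measurement states\<close>

definition rest_basis :: "nat \<Rightarrow> ((nat \<Rightarrow> 'a) \<times> (nat \<Rightarrow> 'b)) set" where
  "rest_basis n = strings {2..n} \<times> strings {2..n}"

text \<open>Written as an update at system 1, so that it accepts labels of all systems as well as
  labels of the systems from 2 on; the positivity proof for branches uses it in both ways.\<close>

definition with_first :: "'a \<times> 'b \<Rightarrow> (nat \<Rightarrow> 'a) \<times> (nat \<Rightarrow> 'b) \<Rightarrow> (nat \<Rightarrow> 'a) \<times> (nat \<Rightarrow> 'b)" where
  "with_first c r = ((fst r)(1 := fst c), (snd r)(1 := snd c))"

definition first_of :: "(nat \<Rightarrow> 'a) \<times> (nat \<Rightarrow> 'b) \<Rightarrow> 'a \<times> 'b" where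
  "first_of i = (fst i 1, snd i 1)"

lemma with_first_simps [simp]:
  "first_of (with_first c r) = c" "with_first c (with_first d r) = with_first c r"
  by (simp_all add: with_first_def first_of_def)

lemma finite_joint_basis [simp]:
  "finite (joint_basis n :: ((nat \<Rightarrow> 'a::finite) \<times> (nat \<Rightarrow> 'b::finite)) set)"
  by (simp add: joint_basis_def)

lemma fun_upd_in_strings:
  assumes "1 \<le> n" "u \<in> strings {2..n}"
  shows "u(1 := a) \<in> strings {1..n}"
  using assms unfolding strings_def PiE_def extensional_def by auto

lemma with_first_in_joint_basis:
  assumes "1 \<le> n" "r \<in> rest_basis n"
  shows "with_first c r \<in> joint_basis n"
  using assms by (auto simp: with_first_def rest_basis_def joint_basis_def intro!: fun_upd_in_strings
      simp del: One_nat_def)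

lemma sum_joint_basis:
  fixes h :: "(nat \<Rightarrow> 'a) \<times> (nat \<Rightarrow> 'b) \<Rightarrow> 'c::comm_monoid_add"
  assumes n: "1 \<le> n"
  shows "(\<Sum>i\<in>joint_basis n. h i) = (\<Sum>c\<in>UNIV. \<Sum>r\<in>rest_basis n. h (with_first c r))"
proof -
  have "(\<Sum>c\<in>UNIV. \<Sum>r\<in>rest_basis n. h (with_first c r))
      = (\<Sum>(c, r)\<in>UNIV \<times> rest_basis n. h (with_first c r))"
    by (rule sum.cartesian_product)
  also have "\<dots> = (\<Sum>i\<in>joint_basis n. h i)"
  \<comment> \<open>The inverse resets entry 1 to \<open>undefined\<close>, the value that strings
    on \<open>{2..n}\<close> take there.\<close>
  proof (rule sum.reindex_bij_witness[of _
        "\<lambda>i. (first_of i, ((fst i)(1 := undefined), (snd i)(1 := undefined)))" "\<lambda>(c, r). with_first c r"])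
    fix x :: "('a \<times> 'b) \<times> (nat \<Rightarrow> 'a) \<times> (nat \<Rightarrow> 'b)" assume x: "x \<in> UNIV \<times> rest_basis n"
    obtain c u v where "x = (c, u, v)" by (metis prod.exhaust)
    with x have u: "x = (c, u, v)" "u 1 = undefined" "v 1 = undefined"
      by (auto simp: rest_basis_def strings_def PiE_def extensional_def)
    show "(first_of (case x of (c, r) \<Rightarrow> with_first c r), (fst (case x of (c, r) \<Rightarrow> with_first c r))(1 := undefined),
         (snd (case x of (c, r) \<Rightarrow> with_first c r))(1 := undefined)) = x"
      using u by (auto simp: with_first_def first_of_def fun_eq_iff)
    show "(case x of (c, r) \<Rightarrow> with_first c r) \<in> joint_basis n"
      using x with_first_in_joint_basis[OF n] by auto
  next
    fix i :: "(nat \<Rightarrow> 'a) \<times> (nat \<Rightarrow> 'b)" assume i: "i \<in> joint_basis n"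
    show "(case (first_of i, (fst i)(1 := undefined), (snd i)(1 := undefined)) of (c, r) \<Rightarrow> with_first c r) = i"
      by (simp add: with_first_def first_of_def)
    show "(first_of i, (fst i)(1 := undefined), (snd i)(1 := undefined)) \<in> UNIV \<times> rest_basis n"
      using i by (auto simp: rest_basis_def joint_basis_def strings_def PiE_def extensional_def)
  qed auto
  finally show ?thesis by simp
qed

lemma reduced_first_eq:
  "reduced_first n X c c' = (\<Sum>r\<in>rest_basis n. X (with_first c r) (with_first c' r))"
  by (cases c; cases c') (simp add: reduced_first_def rest_basis_def with_first_def
      sum.cartesian_product case_prod_beta)

lemma reduced_first_cong:
  assumes "1 \<le> n" "\<And>i j. i \<in> joint_basis n \<Longrightarrow> j \<in> joint_basis n \<Longrightarrow> X i j = Y i j"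
  shows "reduced_first n X = reduced_first n Y"
  unfolding fun_eq_iff reduced_first_eq
  by (intro allI sum.cong refl assms(2) with_first_in_joint_basis assms(1))

lemma op_trace_reduced_first:
  "1 \<le> n \<Longrightarrow> op_trace UNIV (reduced_first n X)
     = op_trace (joint_basis n) (X :: ((nat \<Rightarrow> 'a::finite) \<times> (nat \<Rightarrow> 'b::finite)) op)"
  by (simp add: op_trace_def reduced_first_eq sum_joint_basis)

section \<open>Branches as sums over basis labels\<close>

abbreviation branch_op where
  "branch_op n mA mB E F \<equiv> tensor (extend_op n (blk mA) E) (extend_op n (blk mB) F)"

lemma branch_eq:
  "branch n mA mB P Q \<rho> x w c c' = (\<Sum>r\<in>rest_basis n. \<Sum>k\<in>joint_basis n.
     branch_op n mA mB (P x) (Q w) (with_first c r) k * \<rho> k (with_first c' r))"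
  by (simp add: branch_def reduced_first_eq op_mult_def)

text \<open>Bilinearity of a branch in the two measurement operators. It serves both the
  coarse-graining to types and the summation over all outcomes.\<close>

lemma branch_sum:
  assumes P: "P x = (\<lambda>i j. \<Sum>y\<in>Y. P' y i j)" and Q: "Q w = (\<lambda>i j. \<Sum>z\<in>Z. Q' z i j)"
  shows "branch n mA mB P Q \<rho> x w = (\<lambda>c c'. \<Sum>y\<in>Y. \<Sum>z\<in>Z. branch n mA mB P' Q' \<rho> y z c c')"
proof (intro ext)
  fix c c'
  have "extend_op n S (P x) i k = (\<Sum>y\<in>Y. extend_op n S (P' y) i k)"
    "extend_op n S (Q w) j l = (\<Sum>z\<in>Z. extend_op n S (Q' z) j l)" for S i k j l
    by (auto simp: extend_op_def P Q intro!: sum.neutral)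
  then have "branch_op n mA mB (P x) (Q w) i k
      = (\<Sum>(y, z)\<in>Y \<times> Z. branch_op n mA mB (P' y) (Q' z) i k)" for i k
    by (cases i; cases k)
       (simp add: tensor_def sum_product sum.cartesian_product)
  then have "branch n mA mB P Q \<rho> x w c c' = (\<Sum>r\<in>rest_basis n. \<Sum>k\<in>joint_basis n.
     \<Sum>(y, z)\<in>Y \<times> Z. branch_op n mA mB (P' y) (Q' z) (with_first c r) k * \<rho> k (with_first c' r))"
    by (simp add: branch_eq sum_distrib_right case_prod_beta)
  also have "\<dots> = (\<Sum>(y, z)\<in>Y \<times> Z. \<Sum>r\<in>rest_basis n. \<Sum>k\<in>joint_basis n.
     branch_op n mA mB (P' y) (Q' z) (with_first c r) k * \<rho> k (with_first c' r))"
    unfolding case_prod_beta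
    by (subst sum.swap[of _ "Y \<times> Z"]) (intro sum.cong refl sum.swap)
  finally show "branch n mA mB P Q \<rho> x w c c' = (\<Sum>y\<in>Y. \<Sum>z\<in>Z. branch n mA mB P' Q' \<rho> y z c c')"
    by (simp only: branch_eq sum.cartesian_product[of _ Z Y])
qed

lemma restrict_blk_in_strings: "restrict i (blk m) \<in> strings (blk m)"
  by (simp add: strings_def)

lemma extend_op_eq_0:
  "q \<in> {1..n} - S \<Longrightarrow> i q \<noteq> k q \<Longrightarrow> extend_op n S E i k = 0"
  by (auto simp: extend_op_def)

lemma extend_op_id:
  assumes E: "\<And>i j. i \<in> strings S \<Longrightarrow> j \<in> strings S \<Longrightarrow> E i j = id_op i j"
    and ik: "i \<in> strings {1..n}" "k \<in> strings {1..n}"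
  shows "extend_op n S E i k = id_op i k"
proof -
  have "i = k" if "\<forall>q\<in>{1..n} - S. i q = k q" "restrict i S = restrict k S"
  proof (rule PiE_ext[OF ik[unfolded strings_def]])
    fix q assume "q \<in> {1..n}"
    with that show "i q = k q" by (cases "q \<in> S") (auto dest: fun_cong[of _ _ q])
  qed
  moreover have "restrict j S \<in> strings S" for j :: "nat \<Rightarrow> 'a" by (simp add: strings_def)
  ultimately show ?thesis by (auto simp: extend_op_def E id_op_def)
qed

lemma branch_complete:
  fixes \<rho> :: "((nat \<Rightarrow> 'a::finite) \<times> (nat \<Rightarrow> 'b::finite)) op"
  assumes n: "1 \<le> n"
    and P: "\<And>i j. i \<in> strings (blk mA) \<Longrightarrow> j \<in> strings (blk mA) \<Longrightarrow> (\<Sum>x\<in>X. P x i j) = id_op i j"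
    and Q: "\<And>i j. i \<in> strings (blk mB) \<Longrightarrow> j \<in> strings (blk mB) \<Longrightarrow> (\<Sum>w\<in>W. Q w i j) = id_op i j"
  shows "(\<lambda>c c'. \<Sum>x\<in>X. \<Sum>w\<in>W. branch n mA mB P Q \<rho> x w c c') = reduced_first n \<rho>"
proof -
  \<comment> \<open>The complete sums are regarded as measurements with the single outcome
    \<open>()\<close>, so that \<open>branch_sum\<close> applies; their joint operator is the
    identity.\<close>
  define P' Q' where "P' = (\<lambda>_::unit. \<lambda>i j. \<Sum>x\<in>X. P x i j)" "Q' = (\<lambda>_::unit. \<lambda>i j. \<Sum>w\<in>W. Q w i j)"
  have "op_mult (joint_basis n) (branch_op n mA mB (P' ()) (Q' ())) \<rho> i j = \<rho> i j"
    if "i \<in> joint_basis n" for i j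
  proof -
    have "branch_op n mA mB (P' ()) (Q' ()) i k = (if k = i then 1 else 0)" if "k \<in> joint_basis n" for k
      using \<open>i \<in> joint_basis n\<close> that
      by (cases i; cases k)
         (auto simp: tensor_def joint_basis_def extend_op_id P'_Q'_def P Q id_op_def)
    then have "op_mult (joint_basis n) (branch_op n mA mB (P' ()) (Q' ())) \<rho> i j
        = (\<Sum>k\<in>joint_basis n. if k = i then \<rho> k j else 0)"
      unfolding op_mult_def by (intro sum.cong refl) simp
    then show ?thesis using that by simp
  qed
  then have "branch n mA mB P' Q' \<rho> () () = reduced_first n \<rho>"
    unfolding branch_def by (intro reduced_first_cong n) auto
  moreover have "branch n mA mB P' Q' \<rho> () () = (\<lambda>c c'. \<Sum>x\<in>X. \<Sum>w\<in>W. branch n mA mB P Q \<rho> x w c c')"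
    by (rule branch_sum) (simp_all add: P'_Q'_def)
  ultimately show ?thesis by simp
qed

section \<open>Positivity and completeness of the measurements\<close>

text \<open>Overwriting \<open>i 1\<close> by \<open>k 1\<close> removes the matching condition at
  system 1. What remains is the entrywise product of the identity kernel on the unmeasured systems
  of \<open>{2..n}\<close> with \<open>P\<close> on the block.\<close>

lemma psd_extend_op_upd:
  fixes P :: "(nat \<Rightarrow> 'a::finite) op"
  assumes P: "psd (strings (blk m)) P"
  shows "psd (strings {1..n}) (\<lambda>i k. extend_op n (blk m) P (i(1 := k 1)) k)"
proof -
  let ?S = "{2..n} - blk m"
  have r: "restrict (i(1 := a)) (blk m) = restrict i (blk m)" for i :: "nat \<Rightarrow> 'a" and a
    by (auto simp: blk_def fun_eq_iff)
  have c: "(\<forall>q\<in>{1..n} - blk m. (i(1 := k 1)) q = k q) \<longleftrightarrow> restrict i ?S = restrict k ?S"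
    for i k :: "nat \<Rightarrow> 'a"
  proof -
    have "restrict i ?S = restrict k ?S \<longleftrightarrow> (\<forall>q\<in>?S. i q = k q)"
      by (auto simp: fun_eq_iff restrict_def)
    also have "\<dots> \<longleftrightarrow> (\<forall>q\<in>{1..n} - blk m. (i(1 := k 1)) q = k q)"
      by (auto simp: Suc_le_eq)
    finally show ?thesis ..
  qed
  have "psd (strings {1..n}) (\<lambda>i k. (if restrict i ?S = restrict k ?S then 1 else 0)
      * P (restrict i (blk m)) (restrict k (blk m)))"
    by (rule psd_schur_product[OF _ psd_indicator_eq psd_pullback[OF P]])
       (auto intro: restrict_blk_in_strings)
  then show ?thesis
    by (rule psd_cong[THEN iffD1, rotated]) (unfold extend_op_def c r, simp)
qed

text \<open>The quadratic form of a branch is \<open>Tr (T \<rho>)\<close> with \<open>T\<close> an entrywise product of positive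
  semidefinite kernels, hence nonnegative by the Schur product theorem.\<close>

lemma psd_branch:
  fixes \<rho> :: "((nat \<Rightarrow> 'a::finite) \<times> (nat \<Rightarrow> 'b::finite)) op"
  assumes n: "1 \<le> n" and \<rho>: "psd (joint_basis n) \<rho>"
    and P: "psd (strings (blk mA)) (P x)" and Q: "psd (strings (blk mB)) (Q w)"
  shows "psd UNIV (branch n mA mB P Q \<rho> x w)"
  unfolding psd_def
proof
  fix v :: "'a \<times> 'b \<Rightarrow> complex"
  let ?J = "joint_basis n :: ((nat \<Rightarrow> 'a) \<times> (nat \<Rightarrow> 'b)) set"
  let ?R = "rest_basis n :: ((nat \<Rightarrow> 'a) \<times> (nat \<Rightarrow> 'b)) set"
  let ?E = "branch_op n mA mB (P x) (Q w)"
  \<comment> \<open>\<open>E\<close> is the branch operator with the identity at system 1 replaced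
    by the all-ones kernel. The rank-one factor in \<open>T\<close> then puts the test vector on
    that system.\<close>
  define E where "E i k = ?E (with_first (first_of k) i) k" for i k
  define T where "T i k = v (first_of i) * cnj (v (first_of k)) * E i k" for i k
  have E_split: "E i k = extend_op n (blk mA) (P x) ((fst i)(1 := fst k 1)) (fst k)
      * extend_op n (blk mB) (Q w) ((snd i)(1 := snd k 1)) (snd k)" for i k
    by (cases i; cases k) (simp add: E_def with_first_def first_of_def tensor_def)
  have EA: "psd ?J (\<lambda>i k. extend_op n (blk mA) (P x) ((fst i)(1 := fst k 1)) (fst k))"
    by (rule psd_pullback[OF psd_extend_op_upd[OF P, of n], where f = fst])
       (auto simp: joint_basis_def)
  have EB: "psd ?J (\<lambda>i k. extend_op n (blk mB) (Q w) ((snd i)(1 := snd k 1)) (snd k))"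
    by (rule psd_pullback[OF psd_extend_op_upd[OF Q, of n], where f = snd])
       (auto simp: joint_basis_def)
  have "psd ?J E"
    unfolding E_split by (rule psd_schur_product[OF finite_joint_basis EA EB])
  then have T: "psd ?J T"
    unfolding T_def by (rule psd_schur_product[OF finite_joint_basis psd_rank_one])
  \<comment> \<open>System 1 lies outside both blocks, so the operator acts there as the identity
    and only \<open>c = first_of k\<close> contributes.\<close>
  have pick: "(\<Sum>c\<in>UNIV. cnj (v c) * ?E (with_first c r) k) = cnj (v (first_of k)) * E r k" for r k
  proof -
    have "?E (with_first c r) k = 0" if "c \<noteq> first_of k" for c
    proof -
      have "1 \<in> {1..n} - blk m" for m using n by (auto simp: blk_def)
      then have "extend_op n (blk mA) (P x) ((fst r)(1 := fst c)) (fst k) = 0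
          \<or> extend_op n (blk mB) (Q w) ((snd r)(1 := snd c)) (snd k) = 0"
        using that by (metis extend_op_eq_0 first_of_def fun_upd_same prod.collapse)
      then show ?thesis by (cases k) (auto simp: tensor_def with_first_def)
    qed
    then have "(\<Sum>c\<in>UNIV. cnj (v c) * ?E (with_first c r) k)
        = (\<Sum>c\<in>{first_of k}. cnj (v c) * ?E (with_first c r) k)"
      by (intro sum.mono_neutral_right) auto
    then show ?thesis by (simp add: E_def)
  qed
  have "(\<Sum>c\<in>UNIV. \<Sum>c'\<in>UNIV. cnj (v c) * branch n mA mB P Q \<rho> x w c c' * v c')
      = (\<Sum>c'\<in>UNIV. \<Sum>c\<in>UNIV. \<Sum>r\<in>?R. \<Sum>k\<in>?J.
          cnj (v c) * ?E (with_first c r) k * (\<rho> k (with_first c' r) * v c'))"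
    by (subst sum.swap) (simp add: branch_eq sum_distrib_left sum_distrib_right mult.assoc)
  also have "\<dots> = (\<Sum>c'\<in>UNIV. \<Sum>r\<in>?R. \<Sum>k\<in>?J. \<Sum>c\<in>UNIV.
          cnj (v c) * ?E (with_first c r) k * (\<rho> k (with_first c' r) * v c'))"
    by (rule sum.cong[OF refl], subst sum.swap, rule sum.cong[OF refl], rule sum.swap)
  also have "\<dots> = (\<Sum>c'\<in>UNIV. \<Sum>r\<in>?R. \<Sum>k\<in>?J. T (with_first c' r) k * \<rho> k (with_first c' r))"
    unfolding sum_distrib_right[symmetric] pick
    by (simp add: T_def E_def mult_ac)
  also have "\<dots> = (\<Sum>i\<in>?J. \<Sum>k\<in>?J. T i k * \<rho> k i)"
    by (rule sum_joint_basis[OF n, symmetric])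
  also have "0 \<le> \<dots>" by (rule psd_trace_product_nonneg[OF finite_joint_basis T \<rho>])
  finally show "0 \<le> (\<Sum>c\<in>UNIV. \<Sum>c'\<in>UNIV. cnj (v c) * branch n mA mB P Q \<rho> x w c c' * v c')" .
qed

text \<open>A tensor product is the entrywise product of kernels pulled back from its factors, one
  for each system of the block.\<close>

lemma psd_string_povm:
  fixes M :: "'y \<Rightarrow> ('a::finite) op"
  assumes "\<And>x. psd UNIV (M x)"
  shows "psd (strings (blk m)) (string_povm m M y)"
  unfolding string_povm_def
proof (rule psd_schur_prod)
  fix k
  show "psd (strings (blk m)) (\<lambda>i j. M (y k) (i k) (j k))"
    by (rule psd_pullback[where f = "\<lambda>i. i k", OF assms]) auto
qed simp

lemma psd_type_povm:
  fixes M :: "'y \<Rightarrow> ('a::finite) op"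
  assumes "\<And>x. psd UNIV (M x)"
  shows "psd (strings (blk m)) (type_povm m M s)"
  unfolding type_povm_def by (rule psd_sum, rule psd_string_povm, rule assms)

lemma sum_string_povm:
  fixes M :: "'y::finite \<Rightarrow> ('a::finite) op"
  assumes "\<And>i j. (\<Sum>x\<in>UNIV. M x i j) = id_op i j"
    and ij: "i \<in> strings (blk m)" "j \<in> strings (blk m)"
  shows "(\<Sum>y\<in>strings (blk m). string_povm m M y i j) = id_op i j"
proof -
  have "(\<Sum>y\<in>strings (blk m). string_povm m M y i j) = (\<Prod>k\<in>blk m. \<Sum>x\<in>UNIV. M x (i k) (j k))"
    unfolding strings_def string_povm_def by (rule prod_sum_PiE[symmetric]) auto
  also have "\<dots> = (\<Prod>k\<in>blk m. if i k = j k then 1 else 0)"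
    by (simp add: assms(1) id_op_def)
  also have "\<dots> = id_op i j"
  proof (cases "i = j")
    case False
    then have "\<exists>k\<in>blk m. i k \<noteq> j k" using ij by (metis PiE_ext strings_def)
    then show ?thesis using False by (auto simp: id_op_def intro!: prod_zero)
  qed (simp add: id_op_def)
  finally show ?thesis .
qed

lemma povm_type_povm:
  fixes M :: "'y::finite \<Rightarrow> ('a::finite) op"
  assumes "povm UNIV UNIV M"
  shows "povm (strings (blk m)) (types m) (type_povm m M)"
proof -
  have "(\<Sum>s\<in>types m. type_povm m M s i j) = id_op i j"
    if "i \<in> strings (blk m)" "j \<in> strings (blk m)" for i j
    unfolding type_povm_def sum_strings_by_type
    using assms that by (intro sum_string_povm) (auto simp: povm_def)
  then show ?thesis using assms by (auto simp: povm_def intro: psd_type_povm)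
qed

section \<open>Consequences of permutation invariance\<close>

text \<open>Row \<open>i\<close> of \<open>U\<close> has its only nonzero entry in column
  \<open>g i\<close>, so both sums of the conjugation collapse and invariance becomes a relabelling
  of the matrix entries.\<close>

lemma conj_invariant_relabel:
  assumes inv: "conj_invariant I U \<rho>" and fin: "finite I" and g: "\<And>i. i \<in> I \<Longrightarrow> g i \<in> I"
    and U: "\<And>i k. i \<in> I \<Longrightarrow> k \<in> I \<Longrightarrow> U i k = (if k = g i then 1 else 0)"
    and ij: "i \<in> I" "j \<in> I"
  shows "\<rho> (g i) (g j) = \<rho> i j"
proof -
  have 1: "op_mult I U \<rho> i k = \<rho> (g i) k" for k
  proof -
    have "op_mult I U \<rho> i k = (\<Sum>l\<in>I. if l = g i then \<rho> l k else 0)"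
      unfolding op_mult_def by (rule sum.cong) (simp_all add: U[OF ij(1)])
    also have "\<dots> = \<rho> (g i) k" using fin g[OF ij(1)] by simp
    finally show ?thesis .
  qed
  have "\<rho> i j = op_mult I (op_mult I U \<rho>) (op_adjoint U) i j"
    using inv ij by (simp add: conj_invariant_def)
  also have "\<dots> = (\<Sum>k\<in>I. op_mult I U \<rho> i k * op_adjoint U k j)"
    by (simp add: op_mult_def)
  also have "\<dots> = (\<Sum>k\<in>I. if k = g j then \<rho> (g i) k else 0)"
    unfolding 1 op_adjoint_def by (rule sum.cong) (simp_all add: U[OF ij(2)])
  also have "\<dots> = \<rho> (g i) (g j)" using fin g[OF ij(2)] by simp
  finally show ?thesis by simp
qed

lemma comp_permutes_in_strings:
  assumes "\<sigma> permutes S" "S \<subseteq> N" "i \<in> strings N"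
  shows "i \<circ> \<sigma> \<in> strings N"
  unfolding strings_def
proof (rule PiE_I)
  fix q assume "q \<notin> N"
  then show "(i \<circ> \<sigma>) q = undefined"
    using permutes_not_in[OF permutes_subset[OF assms(1,2)]] PiE_arb[OF assms(3)[unfolded strings_def]]
    by simp
qed simp

text \<open>Agreement on \<open>{1..n}\<close> is equality of labels by extensionality, which
  identifies the column holding the single 1 of row \<open>i\<close>.\<close>

lemma perm_op_eq:
  assumes "\<sigma> permutes {1..n}" "i \<in> strings {1..n}" "k \<in> strings {1..n}"
  shows "perm_op n \<sigma> i k = (if k = i \<circ> \<sigma> then 1 else 0)"
proof -
  have "(\<forall>q\<in>{1..n}. i (\<sigma> q) = k q) \<longleftrightarrow> k = i \<circ> \<sigma>"
  proof
    assume *: "\<forall>q\<in>{1..n}. i (\<sigma> q) = k q"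
    show "k = i \<circ> \<sigma>"
    proof (rule PiE_ext)
      show "k \<in> {1..n} \<rightarrow>\<^sub>E UNIV" using assms(3) by (simp add: strings_def)
      show "i \<circ> \<sigma> \<in> {1..n} \<rightarrow>\<^sub>E UNIV"
        using comp_permutes_in_strings[OF assms(1) order_refl assms(2)] by (simp add: strings_def)
    qed (use * in simp)
  qed simp
  then show ?thesis unfolding perm_op_def by (rule arg_cong)
qed

text \<open>The two invariances are applied in succession, so the A-systems and the B-systems may be
  permuted independently.\<close>

lemma perm_invariant_relabel:
  fixes \<rho> :: "((nat \<Rightarrow> 'a::finite) \<times> (nat \<Rightarrow> 'b::finite)) op"
  assumes A: "perm_invariant_A n \<rho>" and B: "perm_invariant_B n \<rho>"
    and \<sigma>: "\<sigma> permutes {1..n}" and \<pi>: "\<pi> permutes {1..n}"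
    and i: "i \<in> joint_basis n" and j: "j \<in> joint_basis n"
  shows "\<rho> (fst i \<circ> \<sigma>, snd i \<circ> \<pi>) (fst j \<circ> \<sigma>, snd j \<circ> \<pi>) = \<rho> i j"
proof -
  let ?J = "joint_basis n :: ((nat \<Rightarrow> 'a) \<times> (nat \<Rightarrow> 'b)) set"
  let ?g = "\<lambda>i :: (nat \<Rightarrow> 'a) \<times> (nat \<Rightarrow> 'b). (fst i \<circ> \<sigma>, snd i)"
  let ?h = "\<lambda>i :: (nat \<Rightarrow> 'a) \<times> (nat \<Rightarrow> 'b). (fst i, snd i \<circ> \<pi>)"
  have cA: "conj_invariant ?J (tensor (perm_op n \<sigma>) id_op) \<rho>"
    and cB: "conj_invariant ?J (tensor id_op (perm_op n \<pi>)) \<rho>"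
    using A[unfolded perm_invariant_A_def, rule_format, OF \<sigma>]
      B[unfolded perm_invariant_B_def, rule_format, OF \<pi>] .
  have hJ: "?h i \<in> ?J" if "i \<in> ?J" for i
    using that comp_permutes_in_strings[OF \<pi> order_refl, of "snd i"]
    by (simp add: joint_basis_def mem_Times_iff)
  have gJ: "?g i \<in> ?J" if "i \<in> ?J" for i
    using that comp_permutes_in_strings[OF \<sigma> order_refl, of "fst i"]
    by (simp add: joint_basis_def mem_Times_iff)
  have UA: "tensor (perm_op n \<sigma>) id_op i k = (if k = ?g i then 1 else 0)"
    if "i \<in> ?J" "k \<in> ?J" for i k
    using that perm_op_eq[OF \<sigma>, of "fst i" "fst k"]
    by (cases i; cases k) (auto simp: joint_basis_def tensor_def id_op_def)
  have UB: "tensor id_op (perm_op n \<pi>) i k = (if k = ?h i then 1 else 0)"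
    if "i \<in> ?J" "k \<in> ?J" for i k
    using that perm_op_eq[OF \<pi>, of "snd i" "snd k"]
    by (cases i; cases k) (auto simp: joint_basis_def tensor_def id_op_def)
  have "\<rho> (?g i) (?g j) = \<rho> i j" if "i \<in> ?J" "j \<in> ?J" for i j
    by (rule conj_invariant_relabel[where g = ?g, OF cA finite_joint_basis gJ UA that])
  from this[of "?h i" "?h j"] have "\<rho> (fst i \<circ> \<sigma>, snd i \<circ> \<pi>) (fst j \<circ> \<sigma>, snd j \<circ> \<pi>) = \<rho> (?h i) (?h j)"
    using i j hJ by simp
  also have "\<dots> = \<rho> i j"
    by (rule conj_invariant_relabel[where g = ?h, OF cB finite_joint_basis hJ UB i j])
  finally show ?thesis .
qed

lemma sum_strings_comp:
  fixes h :: "(nat \<Rightarrow> 'a) \<Rightarrow> 'c::comm_monoid_add"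
  assumes "\<sigma> permutes S" "S \<subseteq> N"
  shows "(\<Sum>u\<in>strings N. h (u \<circ> \<sigma>)) = (\<Sum>u\<in>strings N. h u)"
proof (rule sum.reindex_bij_witness[of _ "\<lambda>u. u \<circ> inv_into UNIV \<sigma>" "\<lambda>u. u \<circ> \<sigma>"])
  fix u :: "nat \<Rightarrow> 'a" assume u: "u \<in> strings N"
  show "u \<circ> \<sigma> \<in> strings N" "u \<circ> inv_into UNIV \<sigma> \<in> strings N"
    using comp_permutes_in_strings[OF assms u] comp_permutes_in_strings[OF permutes_inv[OF assms(1)] assms(2) u] .
  show "u \<circ> inv_into UNIV \<sigma> \<circ> \<sigma> = u" "u \<circ> \<sigma> \<circ> inv_into UNIV \<sigma> = u"
    by (simp_all add: comp_assoc permutes_inv_o[OF assms(1)])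
qed simp

lemma sum_strings_pair_comp:
  assumes "\<sigma> permutes S" "S \<subseteq> N" "\<pi> permutes S'" "S' \<subseteq> N'"
  shows "(\<Sum>i\<in>strings N \<times> strings N'. h (fst i \<circ> \<sigma>, snd i \<circ> \<pi>)) = (\<Sum>i\<in>strings N \<times> strings N'. h i)"
proof -
  have "(\<Sum>u\<in>strings N. \<Sum>v\<in>strings N'. h (u \<circ> \<sigma>, v \<circ> \<pi>)) = (\<Sum>u\<in>strings N. \<Sum>v\<in>strings N'. h (u, v \<circ> \<pi>))"
    by (rule sum_strings_comp[OF assms(1,2)])
  also have "\<dots> = (\<Sum>u\<in>strings N. \<Sum>v\<in>strings N'. h (u, v))"
    by (intro sum.cong refl sum_strings_comp[OF assms(3,4)])
  finally show ?thesis by (simp add: sum.cartesian_product case_prod_beta)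
qed

text \<open>Permuting outcomes and labels together only reorders the factors of the product; the
  matching condition concerns systems that \<open>\<sigma>\<close> fixes.\<close>

lemma extend_op_string_povm_comp:
  assumes \<sigma>: "\<sigma> permutes blk m"
  shows "extend_op n (blk m) (string_povm m M (y \<circ> \<sigma>)) (i \<circ> \<sigma>) (k \<circ> \<sigma>)
       = extend_op n (blk m) (string_povm m M y) i k"
proof -
  have "(\<Prod>q\<in>blk m. M (y (\<sigma> q)) (i (\<sigma> q)) (k (\<sigma> q))) = (\<Prod>q\<in>blk m. M (y q) (i q) (k q))"
    using prod.permute[OF \<sigma>, of "\<lambda>q. M (y q) (i q) (k q)"] by (simp add: o_def)
  moreover have "(\<forall>q\<in>{1..n} - blk m. (i \<circ> \<sigma>) q = (k \<circ> \<sigma>) q) \<longleftrightarrow> (\<forall>q\<in>{1..n} - blk m. i q = k q)"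
    using \<sigma> by (simp add: permutes_not_in)
  ultimately show ?thesis by (simp add: extend_op_def string_povm_def)
qed

lemma blk_subset: "1 \<le> n \<Longrightarrow> m \<le> n - 1 \<Longrightarrow> blk m \<subseteq> {2..n}"
  by (auto simp: blk_def)

text \<open>The traced-out label and the inner summation label are relabelled by the same pair of
  permutations. This commutes with inserting \<open>c\<close> because system 1 is fixed; the
  operator passes the permutations to the outcome strings and \<open>\<rho>\<close> absorbs
  them.\<close>

lemma branch_permute:
  fixes \<rho> :: "((nat \<Rightarrow> 'a::finite) \<times> (nat \<Rightarrow> 'b::finite)) op"
  assumes n: "1 \<le> n" "mA \<le> n - 1" "mB \<le> n - 1"
    and A: "perm_invariant_A n \<rho>" and B: "perm_invariant_B n \<rho>"
    and \<sigma>: "\<sigma> permutes blk mA" and \<pi>: "\<pi> permutes blk mB"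
  shows "branch n mA mB (string_povm mA MA) (string_povm mB MB) \<rho> (y \<circ> \<sigma>) (z \<circ> \<pi>)
       = branch n mA mB (string_povm mA MA) (string_povm mB MB) \<rho> y z"
proof (intro ext)
  fix c c'
  let ?J = "joint_basis n :: ((nat \<Rightarrow> 'a) \<times> (nat \<Rightarrow> 'b)) set"
  let ?R = "rest_basis n :: ((nat \<Rightarrow> 'a) \<times> (nat \<Rightarrow> 'b)) set"
  let ?E = "\<lambda>y z. branch_op n mA mB (string_povm mA MA y) (string_povm mB MB z)"
  define g :: "(nat \<Rightarrow> 'a) \<times> (nat \<Rightarrow> 'b) \<Rightarrow> (nat \<Rightarrow> 'a) \<times> (nat \<Rightarrow> 'b)"
    where "g i = (fst i \<circ> \<sigma>, snd i \<circ> \<pi>)" for i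
  have s2: "blk mA \<subseteq> {2..n}" "blk mB \<subseteq> {2..n}" using blk_subset[OF n(1,2)] blk_subset[OF n(1,3)] by auto
  have s1: "blk mA \<subseteq> {1..n}" "blk mB \<subseteq> {1..n}" using s2 by force+
  have gJ: "(\<Sum>i\<in>?J. h (g i)) = (\<Sum>i\<in>?J. h i)" for h :: "_ \<Rightarrow> complex"
    unfolding joint_basis_def g_def by (rule sum_strings_pair_comp[OF \<sigma> s1(1) \<pi> s1(2)])
  have gR: "(\<Sum>i\<in>?R. h (g i)) = (\<Sum>i\<in>?R. h i)" for h :: "_ \<Rightarrow> complex"
    unfolding rest_basis_def g_def by (rule sum_strings_pair_comp[OF \<sigma> s2(1) \<pi> s2(2)])
  have 1: "(\<tau> q = 1) = (q = 1)" if "\<tau> permutes blk m" for \<tau> q m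
  proof -
    have "1 \<notin> blk m" by (simp add: blk_def)
    then show ?thesis using that by (metis permutes_def)
  qed
  have gw: "with_first c (g r) = g (with_first c r)" for c r
    by (simp add: with_first_def g_def fun_eq_iff 1[OF \<sigma>] 1[OF \<pi>] del: One_nat_def)
  have E: "?E (y \<circ> \<sigma>) (z \<circ> \<pi>) (g i) (g k) = ?E y z i k" for i k
    by (cases i; cases k) (simp add: tensor_def g_def extend_op_string_povm_comp[OF \<sigma>]
        extend_op_string_povm_comp[OF \<pi>])
  have \<rho>: "\<rho> (g i) (g j) = \<rho> i j" if "i \<in> ?J" "j \<in> ?J" for i j
    unfolding g_def
    by (rule perm_invariant_relabel[OF A B permutes_subset[OF \<sigma> s1(1)] permutes_subset[OF \<pi> s1(2)] that])
  have "branch n mA mB (string_povm mA MA) (string_povm mB MB) \<rho> (y \<circ> \<sigma>) (z \<circ> \<pi>) c c'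
      = (\<Sum>r\<in>?R. \<Sum>k\<in>?J. ?E (y \<circ> \<sigma>) (z \<circ> \<pi>) (with_first c (g r)) (g k)
           * \<rho> (g k) (with_first c' (g r)))"
    unfolding branch_eq
    by (rule trans[OF gR[symmetric]], rule sum.cong[OF refl], rule gJ[symmetric])
  also have "\<dots> = (\<Sum>r\<in>?R. \<Sum>k\<in>?J. ?E y z (with_first c r) k * \<rho> k (with_first c' r))"
    unfolding gw E by (intro sum.cong refl) (simp add: \<rho> with_first_in_joint_basis[OF n(1)] del: One_nat_def)
  finally show "branch n mA mB (string_povm mA MA) (string_povm mB MB) \<rho> (y \<circ> \<sigma>) (z \<circ> \<pi>) c c'
       = branch n mA mB (string_povm mA MA) (string_povm mB MB) \<rho> y z c c'"
    by (simp add: branch_eq)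
qed

section \<open>Entropies of block-diagonal operators\<close>

text \<open>\<open>op_mat\<close> for an enumeration of one's choice: the block form of a disjoint
  union appears only when one part is listed before the other.\<close>

definition enum_mat :: "nat \<Rightarrow> (nat \<Rightarrow> 'i) \<Rightarrow> 'i op \<Rightarrow> complex mat" where
  "enum_mat N e A = mat N N (\<lambda>(k, l). A (e k) (e l))"

text \<open>Two enumerations of the same set are matched by a permutation matrix \<open>P\<close>
  with inverse \<open>Q\<close>, which makes the two matrices similar.\<close>

lemma char_poly_enum_mat:
  assumes e: "bij_betw e {..<N} I" and f: "bij_betw f {..<N} I"
  shows "char_poly (enum_mat N e A) = char_poly (enum_mat N f A)"
proof -
  define P where "P = (mat N N (\<lambda>(k, l). if e k = f l then 1 else 0) :: complex mat)"
  define Q where "Q = (mat N N (\<lambda>(k, l). if f k = e l then 1 else 0) :: complex mat)"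
  have pick: "(\<Sum>l = 0..<N. if g l = x then h l else 0) = h m"
    if "bij_betw g {..<N} I" "m < N" "g m = x" for g x h m
  proof -
    have "(\<Sum>l = 0..<N. if g l = x then h l else 0) = (\<Sum>l = 0..<N. if l = m then h l else 0)"
      using that unfolding bij_betw_def inj_on_def by (intro sum.cong refl) auto
    then show ?thesis using that by simp
  qed
  have ex: "\<exists>m<N. g m = h k" if "bij_betw g {..<N} I" "bij_betw h {..<N} I" "k < N" for g h k
    using that by (metis bij_betw_def imageE imageI lessThan_iff)
  have eqI: "e k = e l \<longleftrightarrow> k = l" "f k = f l \<longleftrightarrow> k = l" if "k < N" "l < N" for k l
    using that e f by (auto simp: bij_betw_def inj_on_def)
  have "P * Q = 1\<^sub>m N"
  proof (rule eq_matI)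
    fix k l assume kl: "k < dim_row (1\<^sub>m N :: complex mat)" "l < dim_col (1\<^sub>m N :: complex mat)"
    obtain m where m: "m < N" "f m = e k" using ex[OF f e, of k] kl by auto
    have "(P * Q) $$ (k, l) = (\<Sum>r = 0..<N. if f r = e k then if f r = e l then 1 else 0 else 0)"
      using kl by (auto simp: P_def Q_def scalar_prod_def intro!: sum.cong)
    also have "\<dots> = (if f m = e l then 1 else 0)" by (rule pick[OF f m])
    finally show "(P * Q) $$ (k, l) = 1\<^sub>m N $$ (k, l)" using kl m eqI by auto
  qed (auto simp: P_def Q_def)
  moreover have "Q * P = 1\<^sub>m N"
  proof (rule eq_matI)
    fix k l assume kl: "k < dim_row (1\<^sub>m N :: complex mat)" "l < dim_col (1\<^sub>m N :: complex mat)"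
    obtain m where m: "m < N" "e m = f k" using ex[OF e f, of k] kl by auto
    have "(Q * P) $$ (k, l) = (\<Sum>r = 0..<N. if e r = f k then if e r = f l then 1 else 0 else 0)"
      using kl by (auto simp: P_def Q_def scalar_prod_def intro!: sum.cong)
    also have "\<dots> = (if e m = f l then 1 else 0)" by (rule pick[OF e m])
    finally show "(Q * P) $$ (k, l) = 1\<^sub>m N $$ (k, l)" using kl m eqI by auto
  qed (auto simp: P_def Q_def)
  moreover have "enum_mat N e A = P * enum_mat N f A * Q"
  proof (rule eq_matI)
    fix k l assume kl: "k < dim_row (P * enum_mat N f A * Q)" "l < dim_col (P * enum_mat N f A * Q)"
    then have kl: "k < N" "l < N" by (auto simp: P_def Q_def)
    obtain m where m: "m < N" "f m = e k" using ex[OF f e, of k] kl by auto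
    obtain m' where m': "m' < N" "f m' = e l" using ex[OF f e, of l] kl by auto
    have 1: "(P * enum_mat N f A) $$ (k, r) = A (e k) (f r)" if "r < N" for r
    proof -
      have "(P * enum_mat N f A) $$ (k, r) = (\<Sum>q = 0..<N. if f q = e k then A (f q) (f r) else 0)"
        using kl that by (auto simp: P_def enum_mat_def scalar_prod_def intro!: sum.cong)
      then show ?thesis using pick[OF f m, of "\<lambda>q. A (f q) (f r)"] m by simp
    qed
    have "(P * enum_mat N f A * Q) $$ (k, l) = (\<Sum>r = 0..<N. (P * enum_mat N f A) $$ (k, r) * Q $$ (r, l))"
      using kl by (simp add: P_def Q_def enum_mat_def scalar_prod_def)
    also have "\<dots> = (\<Sum>r = 0..<N. if f r = e l then A (e k) (f r) else 0)"
      using kl 1 by (auto simp: Q_def intro!: sum.cong)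
    also have "\<dots> = A (e k) (e l)" using pick[OF f m', of "\<lambda>r. A (e k) (f r)"] m' by simp
    finally show "enum_mat N e A $$ (k, l) = (P * enum_mat N f A * Q) $$ (k, l)"
      using kl by (simp add: enum_mat_def)
  qed (auto simp: P_def Q_def enum_mat_def)
  ultimately have "similar_mat (enum_mat N e A) (enum_mat N f A)"
    by (intro similar_matI[of _ _ P Q N]) (auto simp: P_def Q_def enum_mat_def)
  then show ?thesis by (rule char_poly_similar)
qed

lemma char_poly_op_mat:
  assumes "finite I" "bij_betw e {..<card I} I"
  shows "char_poly (op_mat I A) = char_poly (enum_mat (card I) e A)"
  using char_poly_enum_mat[OF bij_betw_from_nat_into_finite[OF assms(1)] assms(2), of A]
  by (simp add: op_mat_def enum_mat_def)

lemma entropy_reindex: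
  assumes "finite I" "inj_on h I"
  shows "entropy (h ` I) A = entropy I (\<lambda>i j. A (h i) (h j))"
proof -
  let ?e = "from_nat_into I"
  have e: "bij_betw ?e {..<card I} I" using assms(1) by (rule bij_betw_from_nat_into_finite)
  then have "bij_betw (h \<circ> ?e) {..<card (h ` I)} (h ` I)"
    using assms by (intro bij_betw_trans[of _ _ I]) (auto simp: card_image bij_betw_def)
  from char_poly_op_mat[OF _ this, of A] assms(1)
  have "char_poly (op_mat (h ` I) A) = char_poly (op_mat I (\<lambda>i j. A (h i) (h j)))"
    using assms by (simp add: op_mat_def enum_mat_def card_image)
  then show ?thesis by (simp add: entropy_def)
qed

lemma char_poly_block_diag:
  fixes A B :: "complex mat"
  assumes "A \<in> carrier_mat k k" "B \<in> carrier_mat l l"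
  shows "char_poly (four_block_mat A (0\<^sub>m k l) (0\<^sub>m l k) B) = char_poly A * char_poly B"
  using assms char_poly_factorized[OF assms(1)] char_poly_factorized[OF assms(2)]
  by (intro char_poly_0_block[OF refl]) auto

text \<open>Listing \<open>I\<close> before \<open>J\<close> gives a block-diagonal matrix. Its
  characteristic polynomial factorises, and the multiset of roots is the union with
  multiplicities.\<close>

lemma entropy_disjoint_union:
  assumes fin: "finite I" "finite J" and disj: "I \<inter> J = {}"
    and zero: "\<And>i j. i \<in> I \<Longrightarrow> j \<in> J \<Longrightarrow> A i j = 0 \<and> A j i = 0"
  shows "entropy (I \<union> J) A = entropy I A + entropy J A"
proof -
  let ?k = "card I" and ?l = "card J" and ?f = "from_nat_into I" and ?g = "from_nat_into J"
  define e where "e m = (if m < ?k then ?f m else ?g (m - ?k))" for m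
  have f: "bij_betw ?f {..<?k} I" and g: "bij_betw ?g {..<?l} J"
    using fin by (auto intro: bij_betw_from_nat_into_finite)
  have c: "card (I \<union> J) = ?k + ?l" using fin disj by (rule card_Un_disjoint)
  have e1: "bij_betw e {..<?k} I" using f by (rule bij_betw_cong[THEN iffD1, rotated]) (simp add: e_def)
  have "bij_betw (\<lambda>m. m - ?k) {?k..<?k+?l} {..<?l}"
    by (rule bij_betw_byWitness[of _ "\<lambda>m. m + ?k"]) auto
  from bij_betw_trans[OF this g] have "bij_betw e {?k..<?k+?l} J"
    by (rule bij_betw_cong[THEN iffD1, rotated]) (simp add: e_def)
  from bij_betw_combine[OF e1 this disj] have e: "bij_betw e {..<card (I \<union> J)} (I \<union> J)"
    by (simp add: c ivl_disj_un)
  have mem: "?f m \<in> I" if "m < ?k" for m using f that by (auto simp: bij_betw_def)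
  have mem': "?g m \<in> J" if "m < ?l" for m using g that by (auto simp: bij_betw_def)
  have "enum_mat (?k + ?l) e A = four_block_mat (op_mat I A) (0\<^sub>m ?k ?l) (0\<^sub>m ?l ?k) (op_mat J A)"
    using zero mem mem' by (intro eq_matI) (auto simp: enum_mat_def op_mat_def e_def)
  with char_poly_op_mat[OF _ e, of A] fin c
  have "char_poly (op_mat (I \<union> J) A) = char_poly (op_mat I A) * char_poly (op_mat J A)"
    by (simp add: char_poly_block_diag op_mat_def)
  \<comment> \<open>The roots of a product add up only for nonzero factors; these are monic.\<close>
  moreover have "char_poly (op_mat K A) \<noteq> 0" for K
    using degree_monic_char_poly[of "op_mat K A" "card K"] by (auto simp: op_mat_def)
  ultimately show ?thesis by (simp add: entropy_def proots_mult)
qed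

lemma entropy_empty: "entropy {} A = 0"
proof -
  have "degree (char_poly (op_mat {} A)) = 0"
    using degree_monic_char_poly[of "op_mat {} A" 0] by (simp add: op_mat_def)
  then have "proots (char_poly (op_mat {} A)) = {#}"
    by (metis degree_eq_zeroE proots_const zero_multiset_def)
  then show ?thesis by (simp add: entropy_def)
qed

section \<open>Triangular forms and scaling of the entropy\<close>

text \<open>The characteristic polynomial of a triangular matrix splits over its diagonal, so the
  diagonal lists the eigenvalues with multiplicity.\<close>

lemma entropy_upper_triangular:
  assumes "similar_mat (op_mat I A) B" "B \<in> carrier_mat n n" "upper_triangular B"
  shows "entropy I A = - (\<Sum>k<n. Re (B $$ (k, k)) * log 2 (Re (B $$ (k, k))))"
proof -
  have "char_poly (op_mat I A) = (\<Prod>a\<leftarrow>diag_mat B. [:- a, 1:])"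
    using char_poly_similar[OF assms(1)] char_poly_upper_triangular[OF assms(2,3)] by simp
  moreover have "proots (\<Prod>a\<leftarrow>xs. [:- a, 1:]) = mset xs" for xs :: "complex list"
    
  proof (induction xs)
    case (Cons a xs)
    have "(\<Prod>a\<leftarrow>xs. [:- a, 1:]) \<noteq> (0 :: complex poly)" by (auto simp: prod_list_zero_iff)
    with Cons show ?case using proots_mult[of "[:- a, 1:]" "\<Prod>a\<leftarrow>xs. [:- a, 1:]"] by simp
  qed simp
  ultimately have "proots (char_poly (op_mat I A)) = mset (diag_mat B)" by simp
  then have "entropy I A = - (\<Sum>e\<leftarrow>diag_mat B. Re e * log 2 (Re e))"
    by (simp add: entropy_def flip: sum_mset_sum_list)
  also have "(\<Sum>e\<leftarrow>diag_mat B. Re e * log 2 (Re e)) = (\<Sum>k<n. Re (B $$ (k, k)) * log 2 (Re (B $$ (k, k))))"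
    using assms(2) by (simp add: diag_mat_def o_def sum_list_distinct_conv_sum_set lessThan_atLeast0)
  finally show ?thesis .
qed

text \<open>Cyclicity of the trace, applied to \<open>A = (P * B) * Q\<close>.\<close>

lemma sum_diag_similar:
  fixes A B :: "complex mat"
  assumes "similar_mat A B" "A \<in> carrier_mat n n"
  shows "(\<Sum>k<n. A $$ (k, k)) = (\<Sum>k<n. B $$ (k, k))"
proof -
  obtain P Q where w: "similar_mat_wit A B P Q" using assms(1) by (auto simp: similar_mat_def)
  note D = similar_mat_witD2[OF assms(2) w]
  define R where "R = P * B"
  have R: "R \<in> carrier_mat n n" "A = R * Q"
    using D(3,5,6) by (simp_all add: R_def)
  have "Q * R = Q * P * B"
    unfolding R_def by (rule assoc_mult_mat[symmetric, OF D(7,6,5)])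
  then have QR: "Q * R = B" using D(2,5) by simp
  have "(\<Sum>k<n. A $$ (k, k)) = (\<Sum>k<n. \<Sum>l<n. R $$ (k, l) * Q $$ (l, k))"
    unfolding R(2) using D(6,7) R(1)
    by (intro sum.cong refl) (simp add: scalar_prod_def lessThan_atLeast0)
  also have "\<dots> = (\<Sum>l<n. \<Sum>k<n. Q $$ (l, k) * R $$ (k, l))"
    by (subst sum.swap) (simp add: mult.commute)
  also have "\<dots> = (\<Sum>l<n. B $$ (l, l))"
    unfolding QR[symmetric] using D(6,7) R(1)
    by (intro sum.cong refl) (simp add: scalar_prod_def lessThan_atLeast0)
  finally show ?thesis .
qed

lemma op_mat_triangular:
  obtains B where "similar_mat (op_mat I A) B" "B \<in> carrier_mat (card I) (card I)" "upper_triangular B"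
proof -
  have c: "op_mat I A \<in> carrier_mat (card I) (card I)" by (simp add: op_mat_def)
  obtain es where "char_poly (op_mat I A) = (\<Prod>a\<leftarrow>es. [:- a, 1:])"
    using char_poly_factorized[OF c] by blast
  from schur_decomposition_exists[OF c this] show thesis using that by blast
qed

lemma op_trace_op_mat:
  assumes "finite I"
  shows "op_trace I A = (\<Sum>k<card I. op_mat I A $$ (k, k))"
  unfolding op_trace_def
  by (subst sum.reindex_bij_betw[OF bij_betw_from_nat_into_finite[OF assms], symmetric])
     (simp add: op_mat_def)

text \<open>Scaling multiplies the diagonal of a triangular form by \<open>c\<close>. The extra
  summand log c is weighted by the sum of that diagonal, which is the trace.\<close>

lemma entropy_scale:
  assumes "finite I" "c > 0"
  shows "entropy I (\<lambda>i j. of_real c * A i j) = c * entropy I A - c * log 2 c * Re (op_trace I A)"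
proof -
  let ?n = "card I"
  obtain B where B: "similar_mat (op_mat I A) B" "B \<in> carrier_mat ?n ?n" "upper_triangular B"
    by (rule op_mat_triangular)
  have "op_mat I (\<lambda>i j. of_real c * A i j) = of_real c \<cdot>\<^sub>m op_mat I A"
    by (intro eq_matI) (auto simp: op_mat_def)
  then have s: "similar_mat (op_mat I (\<lambda>i j. of_real c * A i j)) (of_real c \<cdot>\<^sub>m B)"
    using similar_mat_smult[OF B(1)] by simp
  have ut: "upper_triangular (of_real c \<cdot>\<^sub>m B)" using B(2,3) by (auto simp: upper_triangular_def)
  \<comment> \<open>At x = 0 both sides vanish, so zero eigenvalues are covered.\<close>
  have *: "c * x * log 2 (c * x) = c * (x * log 2 x) + c * log 2 c * x" for x
    using assms(2) by (simp add: log_mult algebra_simps)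
  have "op_trace I A = (\<Sum>k<?n. B $$ (k, k))"
    unfolding op_trace_op_mat[OF assms(1)] by (rule sum_diag_similar[OF B(1)]) (simp add: op_mat_def)
  then have "Re (op_trace I A) = (\<Sum>k<?n. Re (B $$ (k, k)))" by simp
  then show ?thesis
    using entropy_upper_triangular[OF s _ ut, of ?n] entropy_upper_triangular[OF B] B(2)
    by (simp add: * sum.distrib flip: sum_distrib_left)
qed

lemma entropy_singleton: "entropy {x} A = - (Re (A x x) * log 2 (Re (A x x)))"
  by (subst entropy_upper_triangular[of _ _ "op_mat {x} A" 1])
     (use from_nat_into[of "{x}" 0] in \<open>auto simp: op_mat_def upper_triangular_def intro!: similar_mat_refl[of _ 1]\<close>)

lemma entropy_classical:
  assumes "finite I" "finite K" "\<And>i j c d. i \<in> I \<Longrightarrow> j \<in> I \<Longrightarrow> c \<in> K \<Longrightarrow> d \<in> K \<Longrightarrow> c \<noteq> d \<Longrightarrow> X (i, c) (j, d) = 0"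
  shows "entropy (I \<times> K) X = (\<Sum>c\<in>K. entropy I (\<lambda>i j. X (i, c) (j, c)))"
  using assms(2,3)
proof (induction K rule: finite_induct)
  case (insert c K)
  have "I \<times> insert c K = (\<lambda>i. (i, c)) ` I \<union> I \<times> K" by auto
  then have "entropy (I \<times> insert c K) X = entropy ((\<lambda>i. (i, c)) ` I \<union> I \<times> K) X" by simp
  also have "\<dots> = entropy ((\<lambda>i. (i, c)) ` I) X + entropy (I \<times> K) X"
    using assms(1) insert.hyps insert.prems by (intro entropy_disjoint_union) auto
  also have "entropy ((\<lambda>i. (i, c)) ` I) X = entropy I (\<lambda>i j. X (i, c) (j, c))"
    using assms(1) by (intro entropy_reindex) (auto simp: inj_on_def)
  finally show ?case using insert by simp
qed (simp add: entropy_empty)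

lemma entropy_diagonal:
  assumes "finite K" "\<And>c d. c \<in> K \<Longrightarrow> d \<in> K \<Longrightarrow> c \<noteq> d \<Longrightarrow> A c d = 0"
  shows "entropy K A = (\<Sum>c\<in>K. entropy {c} A)"
  using assms
proof (induction K rule: finite_induct)
  case (insert c K)
  have "entropy ({c} \<union> K) A = entropy {c} A + entropy K A"
    using insert.hyps insert.prems by (intro entropy_disjoint_union) auto
  then show ?case using insert by simp
qed (simp add: entropy_empty)

text \<open>The term \<open>t log t\<close>, with \<open>t\<close> the trace, makes the entropy homogeneous of degree one.\<close>

definition entropy_defect :: "'i set \<Rightarrow> 'i op \<Rightarrow> real" where
  "entropy_defect I Z = entropy I Z + Re (op_trace I Z) * log 2 (Re (op_trace I Z))"

text \<open>The contribution of a single outcome to the conditional mutual information. For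
  \<open>Z\<close> of trace t > 0 it is t times the mutual information of Z / t.\<close>

definition block_mutual_info :: "'i set \<Rightarrow> 'j set \<Rightarrow> ('i \<times> 'j) op \<Rightarrow> real" where
  "block_mutual_info I J Z = entropy_defect I (ptrace_snd J Z) + entropy_defect J (ptrace_fst I Z)
     - entropy_defect (I \<times> J) Z"

lemma entropy_defect_scale:
  assumes "finite I" "c > 0"
  shows "entropy_defect I (\<lambda>i j. of_real c * A i j) = c * entropy_defect I A"
proof -
  have "op_trace I (\<lambda>i j. of_real c * A i j) = of_real c * op_trace I A"
    by (simp add: op_trace_def sum_distrib_left)
  then show ?thesis using assms
    by (simp add: entropy_defect_def entropy_scale log_mult algebra_simps)
qed

lemma block_mutual_info_scale:
  assumes "finite I" "finite J" "c > 0"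
  shows "block_mutual_info I J (\<lambda>i j. of_real c * Z i j) = c * block_mutual_info I J Z"
proof -
  have "ptrace_snd J (\<lambda>i j. of_real c * Z i j) = (\<lambda>i j. of_real c * ptrace_snd J Z i j)"
    "ptrace_fst I (\<lambda>i j. of_real c * Z i j) = (\<lambda>i j. of_real c * ptrace_fst I Z i j)"
    by (simp_all add: ptrace_snd_def ptrace_fst_def sum_distrib_left)
  then show ?thesis using assms
    by (simp add: block_mutual_info_def entropy_defect_scale algebra_simps)
qed

text \<open>The register is diagonal with the block traces t as entries, so its entropy is minus the
  sum of t log t. Subtracting it completes the entropy of each block to its defect.\<close>

lemma cond_entropy_classical:
  assumes "finite I" "finite K" "\<And>i j c d. c \<noteq> d \<Longrightarrow> X (i, c) (j, d) = 0"
  shows "cond_entropy I K X = (\<Sum>c\<in>K. entropy_defect I (\<lambda>i j. X (i, c) (j, c)))"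
proof -
  have "entropy K (ptrace_fst I X) = (\<Sum>c\<in>K. entropy {c} (ptrace_fst I X))"
    using assms by (intro entropy_diagonal) (auto simp: ptrace_fst_def)
  moreover have "ptrace_fst I X c c = op_trace I (\<lambda>i j. X (i, c) (j, c))" for c
    by (simp add: ptrace_fst_def op_trace_def)
  ultimately show ?thesis
    using entropy_classical[of I K X] assms
    by (simp add: cond_entropy_def entropy_defect_def entropy_singleton sum_negf sum.distrib)
qed

lemma cond_mutual_info_classical:
  assumes "finite I" "finite J" "finite K" "\<And>i j c d. c \<noteq> d \<Longrightarrow> X (i, c) (j, d) = 0"
  shows "cond_mutual_info I J K X = (\<Sum>c\<in>K. block_mutual_info I J (\<lambda>i j. X (i, c) (j, c)))"
  unfolding cond_mutual_info_def block_mutual_info_def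
  using assms by (subst (1 2 3) cond_entropy_classical)
    (auto simp: on_fst_def ptrace_fst_def ptrace_snd_def sum.distrib sum_subtractf)

section \<open>Coarse-graining to types\<close>

text \<open>A property shared by the identity, channels and measurements, which sends proportional
  branches to proportional operators. With \<open>c = 0\<close> it also keeps the off-diagonal
  blocks of the register zero.\<close>

definition homogeneous :: "('i op \<Rightarrow> 'k op) \<Rightarrow> bool" where
  "homogeneous F \<longleftrightarrow> (\<forall>c X. F (\<lambda>i j. c * X i j) = (\<lambda>k l. c * F X k l))"

lemma homogeneousD: "homogeneous F \<Longrightarrow> F (\<lambda>i j. c * X i j) = (\<lambda>k l. c * F X k l)"
  by (simp add: homogeneous_def)

lemma homogeneous_zero: "homogeneous F \<Longrightarrow> F (\<lambda>i j. 0) = (\<lambda>k l. 0)"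
  using homogeneousD[of F 0] by simp

lemma homogeneous_channel: "channel \<Phi> \<Longrightarrow> homogeneous \<Phi>"
  by (simp add: channel_def homogeneous_def)

lemma homogeneous_meas_channel: "homogeneous (meas_channel M)"
  unfolding homogeneous_def meas_channel_def op_trace_def op_mult_def
  by (auto simp: fun_eq_iff sum_distrib_left mult_ac)

lemma homogeneous_local:
  assumes "homogeneous \<Phi>" "homogeneous \<Psi>"
  shows "homogeneous (on_snd \<Psi> \<circ> on_fst \<Phi>)"
  unfolding homogeneous_def on_fst_def on_snd_def o_def
  by (auto simp: fun_eq_iff homogeneousD[OF assms(1)] homogeneousD[OF assms(2)])

lemma cond_mutual_info_post_meas_state:
  fixes F :: "('a \<times> 'b) op \<Rightarrow> ('c::finite \<times> 'd::finite) op"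
  assumes F: "homogeneous F" and fin: "finite X" "finite W"
  shows "cond_mutual_info UNIV UNIV (X \<times> W) (on_fst F (post_meas_state n mA mB P Q \<rho>))
       = (\<Sum>x\<in>X. \<Sum>w\<in>W. block_mutual_info UNIV UNIV (F (branch n mA mB P Q \<rho> x w)))"
proof -
  let ?S = "on_fst F (post_meas_state n mA mB P Q \<rho>)"
  have off: "?S (i, c) (j, d) = 0" if "c \<noteq> d" for i j c d
    using that by (cases c; cases d)
      (auto simp: on_fst_def post_meas_state_def homogeneous_zero[OF F])
  have diag: "(\<lambda>i j. ?S (i, (x, w)) (j, (x, w))) = F (branch n mA mB P Q \<rho> x w)" for x w
    by (simp add: on_fst_def post_meas_state_def)
  show ?thesis
    using fin by (subst cond_mutual_info_classical)
      (auto simp: off diag sum.cartesian_product intro!: sum.cong)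
qed

section \<open>Marginals and normalised branches\<close>

lemma state_ptrace_snd:
  fixes X :: "('a::finite \<times> 'b::finite) op"
  assumes "state UNIV X"
  shows "state UNIV (ptrace_snd UNIV X)"
proof -
  have "psd UNIV (ptrace_snd UNIV X)"
    unfolding ptrace_snd_def
  proof (rule psd_sum)
    fix k
    show "psd UNIV (\<lambda>i i'. X (i, k) (i', k))"
      by (rule psd_pullback[of UNIV X UNIV "\<lambda>i. (i, k)"]) (use assms in \<open>auto simp: state_def\<close>)
  qed
  moreover have "op_trace UNIV (ptrace_snd UNIV X) = op_trace UNIV X"
    by (simp add: op_trace_def ptrace_snd_def sum.cartesian_product)
  ultimately show ?thesis using assms by (simp add: state_def)
qed

lemma state_ptrace_fst:
  fixes X :: "('a::finite \<times> 'b::finite) op"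
  assumes "state UNIV X"
  shows "state UNIV (ptrace_fst UNIV X)"
proof -
  have "psd UNIV (ptrace_fst UNIV X)"
    unfolding ptrace_fst_def
  proof (rule psd_sum)
    fix k
    show "psd UNIV (\<lambda>j j'. X (k, j) (k, j'))"
      by (rule psd_pullback[of UNIV X UNIV "\<lambda>j. (k, j)"]) (use assms in \<open>auto simp: state_def\<close>)
  qed
  moreover have "op_trace UNIV (ptrace_fst UNIV X) = op_trace UNIV X"
    unfolding op_trace_def ptrace_fst_def by (subst sum.swap) (simp add: sum.cartesian_product)
  ultimately show ?thesis using assms by (simp add: state_def)
qed

text \<open>Supplies a placeholder for the conditional states of type pairs of probability
  zero.\<close>

lemma ex_state: "\<exists>\<sigma> :: 'a::finite op. state UNIV \<sigma>"
proof
  let ?w = "\<lambda>i :: 'a. if i = undefined then 1 else 0 :: complex"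
  show "state UNIV (\<lambda>i j. ?w i * cnj (?w j))"
    unfolding state_def
    using psd_rank_one[of UNIV ?w] by (auto simp: op_trace_def if_distrib cong: if_cong)
qed

lemma branch_cond_state:
  assumes "psd UNIV (branch n mA mB P Q \<rho> x w)"
  shows outcome_prob_nonneg: "0 \<le> outcome_prob n mA mB P Q \<rho> x w"
    and op_trace_branch: "op_trace UNIV (branch n mA mB P Q \<rho> x w) = of_real (outcome_prob n mA mB P Q \<rho> x w)"
    and branch_eq_cond_state:
      "branch n mA mB P Q \<rho> x w i j = of_real (outcome_prob n mA mB P Q \<rho> x w) * cond_state n mA mB P Q \<rho> x w i j"
    and state_cond_state: "0 < outcome_prob n mA mB P Q \<rho> x w \<Longrightarrow> state UNIV (cond_state n mA mB P Q \<rho> x w)"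
proof -
  let ?p = "outcome_prob n mA mB P Q \<rho> x w" and ?b = "branch n mA mB P Q \<rho> x w"
  have t: "0 \<le> op_trace UNIV ?b" by (rule psd_op_trace_nonneg[OF finite assms])
  then show "0 \<le> ?p" by (simp add: outcome_prob_def less_eq_complex_def)
  show tr: "op_trace UNIV ?b = of_real ?p"
    using t by (simp add: outcome_prob_def less_eq_complex_def complex_eq_iff)
  \<comment> \<open>At probability zero \<open>cond_state\<close> is the zero operator, and the
    branch is zero as well because it is positive with trace zero.\<close>
  show "?b i j = of_real ?p * cond_state n mA mB P Q \<rho> x w i j"
    using psd_trace_zero[OF finite assms, of i j] tr by (cases "?p = 0") (simp_all add: cond_state_def)
  assume p: "0 < ?p"
  \<comment> \<open>Dividing by the probability is written as a congruence by a constant diagonal,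
    which preserves positivity.\<close>
  let ?c = "complex_of_real (1 / sqrt ?p)"
  have c: "?c * cnj ?c = 1 / of_real ?p"
    using p by (simp flip: of_real_mult)
  have "psd UNIV (\<lambda>i j. ?c * ?b i j * cnj ?c)" by (rule psd_diag_congruence[OF assms])
  moreover have "(\<lambda>i j. ?c * ?b i j * cnj ?c) = cond_state n mA mB P Q \<rho> x w"
  proof (intro ext)
    fix i j
    have "?c * ?b i j * cnj ?c = ?b i j * (?c * cnj ?c)" by (simp only: mult_ac)
    then show "?c * ?b i j * cnj ?c = cond_state n mA mB P Q \<rho> x w i j"
      unfolding c by (simp add: cond_state_def)
  qed
  moreover have "op_trace UNIV (cond_state n mA mB P Q \<rho> x w) = 1"
    using tr p by (simp add: op_trace_def cond_state_def flip: sum_divide_distrib)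
  ultimately show "state UNIV (cond_state n mA mB P Q \<rho> x w)" by (simp add: state_def)
qed

lemma sum_strings_by_types:
  fixes h :: "(nat \<Rightarrow> 'y::finite) \<Rightarrow> (nat \<Rightarrow> 'z::finite) \<Rightarrow> 'c::comm_monoid_add"
  shows "(\<Sum>y\<in>strings (blk mA). \<Sum>z\<in>strings (blk mB). h y z)
    = (\<Sum>s\<in>types mA. \<Sum>t\<in>types mB. \<Sum>y\<in>strings_of_type mA s. \<Sum>z\<in>strings_of_type mB t. h y z)"
proof -
  have "(\<Sum>y\<in>strings (blk mA). \<Sum>z\<in>strings (blk mB). h y z)
      = (\<Sum>s\<in>types mA. \<Sum>y\<in>strings_of_type mA s. \<Sum>t\<in>types mB. \<Sum>z\<in>strings_of_type mB t. h y z)"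
    by (simp only: sum_strings_by_type)
  also have "\<dots> = (\<Sum>s\<in>types mA. \<Sum>t\<in>types mB. \<Sum>y\<in>strings_of_type mA s. \<Sum>z\<in>strings_of_type mB t. h y z)"
    by (intro sum.cong refl sum.swap)
  finally show ?thesis .
qed

section \<open>The measured invariant state and its type classes\<close>

locale measured_invariant_state =
  fixes n mA mB :: nat
    and \<rho> :: "((nat \<Rightarrow> 'a::finite) \<times> (nat \<Rightarrow> 'b::finite)) op"
    and MA :: "'y::finite \<Rightarrow> 'a op" and MB :: "'z::finite \<Rightarrow> 'b op"
  assumes n: "1 \<le> n" and mA: "mA \<le> n - 1" and mB: "mB \<le> n - 1"
    and rho: "state (joint_basis n) \<rho>"
    and invA: "perm_invariant_A n \<rho>" and invB: "perm_invariant_B n \<rho>"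
    and MA: "povm UNIV UNIV MA" and MB: "povm UNIV UNIV MB"
begin

abbreviation "br \<equiv> branch n mA mB (string_povm mA MA) (string_povm mB MB) \<rho>"
abbreviation "brT \<equiv> branch n mA mB (type_povm mA MA) (type_povm mB MB) \<rho>"
abbreviation "pr \<equiv> outcome_prob n mA mB (string_povm mA MA) (string_povm mB MB) \<rho>"
abbreviation "prT \<equiv> outcome_prob n mA mB (type_povm mA MA) (type_povm mB MB) \<rho>"
abbreviation "cs \<equiv> cond_state n mA mB (string_povm mA MA) (string_povm mB MB) \<rho>"
abbreviation "csT \<equiv> cond_state n mA mB (type_povm mA MA) (type_povm mB MB) \<rho>"

lemma psd_br: "psd UNIV (br y z)" and psd_brT: "psd UNIV (brT s t)"
  using n rho MA MB
  by (auto intro!: psd_branch psd_string_povm psd_type_povm simp: state_def povm_def)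

lemma reduced_first_decomposition:
  "reduced_first n \<rho> = (\<lambda>i j. \<Sum>y\<in>strings (blk mA). \<Sum>z\<in>strings (blk mB). of_real (pr y z) * cs y z i j)"
  unfolding branch_eq_cond_state[OF psd_br, symmetric]
  using MA MB
  by (intro branch_complete[OF n, symmetric] sum_string_povm) (auto simp: povm_def)

lemma sum_prT: "(\<Sum>s\<in>types mA. \<Sum>t\<in>types mB. prT s t) = 1"
proof -
  have "(\<Sum>s\<in>types mA. \<Sum>t\<in>types mB. op_trace UNIV (brT s t)) = op_trace UNIV (reduced_first n \<rho>)"
  proof -
    have "(\<lambda>c c'. \<Sum>s\<in>types mA. \<Sum>t\<in>types mB. brT s t c c') = reduced_first n \<rho>"
      using povm_type_povm[OF MA, of mA] povm_type_povm[OF MB, of mB]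
      by (intro branch_complete[OF n]) (auto simp: povm_def)
    then have "op_trace UNIV (reduced_first n \<rho>)
        = op_trace UNIV (\<lambda>c c'. \<Sum>s\<in>types mA. \<Sum>t\<in>types mB. brT s t c c')" by simp
    also have "\<dots> = (\<Sum>s\<in>types mA. \<Sum>t\<in>types mB. op_trace UNIV (brT s t))"
      unfolding op_trace_def by (subst sum.swap, rule sum.cong[OF refl], rule sum.swap)
    finally show ?thesis ..
  qed
  also have "\<dots> = 1"
    using rho by (simp add: op_trace_reduced_first[OF n] state_def del: One_nat_def)
  finally have "(\<Sum>s\<in>types mA. \<Sum>t\<in>types mB. complex_of_real (prT s t)) = 1"
    by (simp only: op_trace_branch[OF psd_brT])
  then show ?thesis by (simp flip: of_real_sum)
qed

lemma br_same_type:
  fixes y y' :: "nat \<Rightarrow> 'y" and z z' :: "nat \<Rightarrow> 'z"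
  assumes "y \<in> strings (blk mA)" "y' \<in> strings (blk mA)" "type_of_string mA y = type_of_string mA y'"
    and "z \<in> strings (blk mB)" "z' \<in> strings (blk mB)" "type_of_string mB z = type_of_string mB z'"
  shows "br y z = br y' z'"
proof -
  obtain \<sigma> where \<sigma>: "\<sigma> permutes blk mA" "y' = y \<circ> \<sigma>" by (rule same_type_permutation[OF assms(1-3)])
  obtain \<pi> where \<pi>: "\<pi> permutes blk mB" "z' = z \<circ> \<pi>" by (rule same_type_permutation[OF assms(4-6)])
  show ?thesis
    unfolding \<sigma>(2) \<pi>(2) by (rule branch_permute[OF n mA mB invA invB \<sigma>(1) \<pi>(1), symmetric])
qed

lemma pr_cong: "br y z = br y' z' \<Longrightarrow> pr y z = pr y' z'"
  and cs_cong: "br y z = br y' z' \<Longrightarrow> cs y z = cs y' z'"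
  by (simp_all add: outcome_prob_def cond_state_def)

abbreviation "NA s \<equiv> card (strings_of_type mA s :: (nat \<Rightarrow> 'y) set)"
abbreviation "NB t \<equiv> card (strings_of_type mB t :: (nat \<Rightarrow> 'z) set)"

context
  fixes s t and y :: "nat \<Rightarrow> 'y" and z :: "nat \<Rightarrow> 'z"
  assumes y: "y \<in> strings_of_type mA s" and z: "z \<in> strings_of_type mB t"
begin

lemma br_const: "y' \<in> strings_of_type mA s \<Longrightarrow> z' \<in> strings_of_type mB t \<Longrightarrow> br y' z' = br y z"
  using y z by (intro br_same_type) (auto simp: strings_of_type_def)

lemma brT_eq: "brT s t = (\<lambda>c c'. of_real (real (NA s * NB t)) * br y z c c')"
proof -
  have "brT s t = (\<lambda>c c'. \<Sum>y'\<in>strings_of_type mA s. \<Sum>z'\<in>strings_of_type mB t. br y' z' c c')"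
    by (rule branch_sum) (simp_all add: type_povm_def)
  then show ?thesis by (simp add: br_const fun_eq_iff)
qed

lemma prT_eq: "prT s t = real (NA s * NB t) * pr y z"
  by (simp add: outcome_prob_def brT_eq op_trace_def flip: sum_distrib_left)

lemma N_pos: "0 < NA s" "0 < NB t"
  using y z by (auto simp: card_gt_0_iff)

text \<open>The multiplicity of the class occurs in both the branch and its probability and cancels
  in the quotient; it is nonzero because representatives are given.\<close>

lemma csT_eq: "csT s t = cs y z"
  using N_pos by (auto simp: cond_state_def brT_eq prT_eq fun_eq_iff)

end

lemma ex_string_of_type:
  assumes "s \<in> types mA" "t \<in> types mB"
  obtains y z where "(y :: nat \<Rightarrow> 'y) \<in> strings_of_type mA s" "(z :: nat \<Rightarrow> 'z) \<in> strings_of_type mB t"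
  using card_strings_of_type_pos[OF assms(1)] card_strings_of_type_pos[OF assms(2)]
  by (metis card_gt_0_iff ex_in_conv)

lemma prT_eq_sum:
  assumes "s \<in> types mA" "t \<in> types mB"
  shows "prT s t = (\<Sum>y\<in>strings_of_type mA s. \<Sum>z\<in>strings_of_type mB t. pr y z)"
proof -
  obtain y z where yz: "y \<in> strings_of_type mA s" "z \<in> strings_of_type mB t"
    by (rule ex_string_of_type[OF assms])
  have "pr y' z' = pr y z" if "y' \<in> strings_of_type mA s" "z' \<in> strings_of_type mB t" for y' z'
    by (rule pr_cong[OF br_const[OF yz that]])
  then show ?thesis by (simp add: prT_eq[OF yz])
qed

lemma cond_mutual_info_types:
  fixes F :: "('a \<times> 'b) op \<Rightarrow> ('c::finite \<times> 'd::finite) op"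
  assumes F: "homogeneous F"
  shows "cond_mutual_info UNIV UNIV (strings (blk mA) \<times> strings (blk mB))
           (on_fst F (post_meas_state n mA mB (string_povm mA MA) (string_povm mB MB) \<rho>))
       = cond_mutual_info UNIV UNIV (types mA \<times> types mB)
           (on_fst F (post_meas_state n mA mB (type_povm mA MA) (type_povm mB MB) \<rho>))"
proof -
  let ?g = "\<lambda>Z. block_mutual_info UNIV UNIV (F Z)"
  have "(\<Sum>y\<in>strings_of_type mA s. \<Sum>z\<in>strings_of_type mB t. ?g (br y z)) = ?g (brT s t)"
    if st: "s \<in> types mA" "t \<in> types mB" for s t
  proof -
    obtain y z where yz: "y \<in> strings_of_type mA s" "z \<in> strings_of_type mB t"
      by (rule ex_string_of_type[OF st])
    \<comment> \<open>The multiplicity passes through \<open>F\<close> and then through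
      \<open>block_mutual_info\<close>; on the side of the strings the same factor counts equal
      summands.\<close>
    have "?g (brT s t) = real (NA s * NB t) * ?g (br y z)"
      unfolding brT_eq[OF yz] homogeneousD[OF F]
      using N_pos[OF yz] by (intro block_mutual_info_scale) auto
    then show ?thesis by (simp add: br_const[OF yz])
  qed
  then show ?thesis
    by (simp add: cond_mutual_info_post_meas_state[OF F] sum_strings_by_types)
qed

lemma type_decomposition:
  "\<exists>p \<rho>At \<rho>Bt.
     (\<forall>s\<in>types mA. \<forall>t\<in>types mB. 0 \<le> p s t) \<and> (\<Sum>s\<in>types mA. \<Sum>t\<in>types mB. p s t) = 1 \<and>
     (\<forall>s\<in>types mA. \<forall>t\<in>types mB. state UNIV (\<rho>At s t) \<and> state UNIV (\<rho>Bt s t)) \<and>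
     (\<lambda>i j. \<Sum>y\<in>strings (blk mA). \<Sum>z\<in>strings (blk mB). of_real (pr y z) *
         tensor (ptrace_snd UNIV (cs y z)) (ptrace_fst UNIV (cs y z)) i j)
       = (\<lambda>i j. \<Sum>s\<in>types mA. \<Sum>t\<in>types mB. of_real (p s t) * tensor (\<rho>At s t) (\<rho>Bt s t) i j) \<and>
     (\<forall>s\<in>types mA. \<forall>t\<in>types mB.
        p s t = prT s t \<and>
        p s t = (\<Sum>y\<in>strings_of_type mA s. \<Sum>z\<in>strings_of_type mB t. pr y z) \<and>
        (\<forall>y\<in>strings_of_type mA s. \<forall>z\<in>strings_of_type mB t.
           p s t = fact mA / (\<Prod>a\<in>UNIV. fact (s a)) * (fact mB / (\<Prod>b\<in>UNIV. fact (t b))) * pr y z))"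
proof -
  obtain \<sigma>A :: "'a op" and \<sigma>B :: "'b op" where \<sigma>: "state UNIV \<sigma>A" "state UNIV \<sigma>B"
    using ex_state by metis
  \<comment> \<open>A pair of types of probability zero has the zero operator as its
    \<open>csT\<close>, which is no state. An arbitrary state takes its place and enters with weight
    zero.\<close>
  define \<rho>At where "\<rho>At s t = (if 0 < prT s t then ptrace_snd UNIV (csT s t) else \<sigma>A)" for s t
  define \<rho>Bt where "\<rho>Bt s t = (if 0 < prT s t then ptrace_fst UNIV (csT s t) else \<sigma>B)" for s t
  have states: "state UNIV (\<rho>At s t)" "state UNIV (\<rho>Bt s t)" for s t
    using \<sigma> state_cond_state[OF psd_brT]
    by (auto simp: \<rho>At_def \<rho>Bt_def intro: state_ptrace_fst state_ptrace_snd)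
  have "(\<Sum>y\<in>strings_of_type mA s. \<Sum>z\<in>strings_of_type mB t. of_real (pr y z) *
         tensor (ptrace_snd UNIV (cs y z)) (ptrace_fst UNIV (cs y z)) i j)
       = of_real (prT s t) * tensor (\<rho>At s t) (\<rho>Bt s t) i j"
    if st: "s \<in> types mA" "t \<in> types mB" for s t i j
  proof -
    have "of_real (pr y z) * tensor (ptrace_snd UNIV (cs y z)) (ptrace_fst UNIV (cs y z)) i j
        = of_real (pr y z) * tensor (\<rho>At s t) (\<rho>Bt s t) i j"
      if yz: "y \<in> strings_of_type mA s" "z \<in> strings_of_type mB t" for y z
    \<comment> \<open>Both sides vanish at probability zero. Otherwise the pair of types also has
      positive probability, and its conditional state is the one for the strings.\<close>
    proof (cases "pr y z = 0")
      case False
      then have "0 < prT s t"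
        using N_pos[OF yz] outcome_prob_nonneg[OF psd_br, of y z] by (simp add: prT_eq[OF yz])
      then show ?thesis by (simp add: \<rho>At_def \<rho>Bt_def csT_eq[OF yz])
    qed simp
    then have "(\<Sum>y\<in>strings_of_type mA s. \<Sum>z\<in>strings_of_type mB t. of_real (pr y z) *
          tensor (ptrace_snd UNIV (cs y z)) (ptrace_fst UNIV (cs y z)) i j)
        = (\<Sum>y\<in>strings_of_type mA s. \<Sum>z\<in>strings_of_type mB t.
            of_real (pr y z) * tensor (\<rho>At s t) (\<rho>Bt s t) i j)"
      by (intro sum.cong refl)
    then show ?thesis by (simp add: prT_eq_sum[OF st] sum_distrib_right)
  qed
  then have tilde: "(\<lambda>i j. \<Sum>y\<in>strings (blk mA). \<Sum>z\<in>strings (blk mB). of_real (pr y z) *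
         tensor (ptrace_snd UNIV (cs y z)) (ptrace_fst UNIV (cs y z)) i j)
       = (\<lambda>i j. \<Sum>s\<in>types mA. \<Sum>t\<in>types mB. of_real (prT s t) * tensor (\<rho>At s t) (\<rho>Bt s t) i j)"
    by (simp add: sum_strings_by_types)
  have formula: "prT s t = fact mA / (\<Prod>a\<in>UNIV. fact (s a)) * (fact mB / (\<Prod>b\<in>UNIV. fact (t b))) * pr y z"
    if "s \<in> types mA" "t \<in> types mB" "y \<in> strings_of_type mA s" "z \<in> strings_of_type mB t" for s t y z
    unfolding prT_eq[OF that(3,4)] of_nat_mult real_card_strings_of_type[OF that(1)]
      real_card_strings_of_type[OF that(2)] ..
  show ?thesis
    by (intro exI[of _ prT] exI[of _ \<rho>At] exI[of _ \<rho>Bt] conjI ballI refl outcome_prob_nonneg[OF psd_brT]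
        sum_prT states tilde prT_eq_sum formula)
qed

end

lemma on_fst_id: "on_fst (\<lambda>X. X) Z = Z"
  by (auto simp: on_fst_def fun_eq_iff)

theorem proposition4p11:
  fixes n mA mB :: nat
    and \<rho> :: "((nat \<Rightarrow> 'a::finite) \<times> (nat \<Rightarrow> 'b::finite)) op"
    and MA :: "'y::finite \<Rightarrow> 'a op"
    and MB :: "'z::finite \<Rightarrow> 'b op"
  defines "YS \<equiv> strings (blk mA)"
    and "ZS \<equiv> strings (blk mB)"
    and "pr \<equiv> outcome_prob n mA mB (string_povm mA MA) (string_povm mB MB) \<rho>"
    and "\<rho>AB \<equiv> cond_state n mA mB (string_povm mA MA) (string_povm mB MB) \<rho>"
    and "\<rho>A \<equiv> (\<lambda>y z. ptrace_snd UNIV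
                 (cond_state n mA mB (string_povm mA MA) (string_povm mB MB) \<rho> y z))"
    and "\<rho>B \<equiv> (\<lambda>y z. ptrace_fst UNIV
                 (cond_state n mA mB (string_povm mA MA) (string_povm mB MB) \<rho> y z))"
    and "\<rho>YZ \<equiv> post_meas_state n mA mB (string_povm mA MA) (string_povm mB MB) \<rho>"
    and "\<rho>T \<equiv> post_meas_state n mA mB (type_povm mA MA) (type_povm mB MB) \<rho>"
    and "TA \<equiv> types mA"
    and "TB \<equiv> types mB"
  assumes n: "1 \<le> n" and mA: "mA \<le> n - 1" and mB: "mB \<le> n - 1"
    and rho: "state (joint_basis n) \<rho>"
    and invA: "perm_invariant_A n \<rho>"
    and invB: "perm_invariant_B n \<rho>"
    and MA: "povm UNIV UNIV MA"
    and MB: "povm UNIV UNIV MB"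
  shows
     "reduced_first n \<rho> = (\<lambda>i j. \<Sum>y\<in>YS. \<Sum>z\<in>ZS. of_real (pr y z) * \<rho>AB y z i j)
      \<and>
      (\<exists>p \<rho>At \<rho>Bt.
         (\<forall>s\<in>TA. \<forall>t\<in>TB. 0 \<le> p s t) \<and> (\<Sum>s\<in>TA. \<Sum>t\<in>TB. p s t) = 1 \<and>
         (\<forall>s\<in>TA. \<forall>t\<in>TB. state UNIV (\<rho>At s t) \<and> state UNIV (\<rho>Bt s t)) \<and>
         (\<lambda>i j. \<Sum>y\<in>YS. \<Sum>z\<in>ZS. of_real (pr y z) * tensor (\<rho>A y z) (\<rho>B y z) i j)
           = (\<lambda>i j. \<Sum>s\<in>TA. \<Sum>t\<in>TB. of_real (p s t) * tensor (\<rho>At s t) (\<rho>Bt s t) i j) \<and>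
         (\<forall>s\<in>TA. \<forall>t\<in>TB.
            p s t = outcome_prob n mA mB (type_povm mA MA) (type_povm mB MB) \<rho> s t \<and>
            p s t = (\<Sum>y\<in>strings_of_type mA s. \<Sum>z\<in>strings_of_type mB t. pr y z) \<and>
            (\<forall>y\<in>strings_of_type mA s. \<forall>z\<in>strings_of_type mB t.
               p s t = fact mA / (\<Prod>a\<in>UNIV. fact (s a)) * (fact mB / (\<Prod>b\<in>UNIV. fact (t b)))
                       * pr y z)))
      \<and>
      (\<forall>y\<in>YS. \<forall>y'\<in>YS. type_of_string mA y = type_of_string mA y' \<longrightarrow>
         (\<forall>z\<in>ZS. pr y z = pr y' z \<and>
            (0 < pr y z \<longrightarrow> \<rho>A y z = \<rho>A y' z \<and> \<rho>B y z = \<rho>B y' z)))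
      \<and>
      (\<forall>z\<in>ZS. \<forall>z'\<in>ZS. type_of_string mB z = type_of_string mB z' \<longrightarrow>
         (\<forall>y\<in>YS. pr y z = pr y z' \<and>
            (0 < pr y z \<longrightarrow> \<rho>A y z = \<rho>A y z' \<and> \<rho>B y z = \<rho>B y z')))
      \<and>
      povm (strings (blk mA)) TA (type_povm mA MA) \<and>
      povm (strings (blk mB)) TB (type_povm mB MB)
      \<and>
      cond_mutual_info UNIV UNIV (YS \<times> ZS) \<rho>YZ = cond_mutual_info UNIV UNIV (TA \<times> TB) \<rho>T
      \<and>
      (\<forall>(\<Phi> :: 'a op \<Rightarrow> 'c::finite op) (\<Psi> :: 'b op \<Rightarrow> 'd::finite op).
         channel \<Phi> \<and> channel \<Psi> \<longrightarrow>
         cond_mutual_info UNIV UNIV (YS \<times> ZS) (local_processing \<Phi> \<Psi> \<rho>YZ)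
           = cond_mutual_info UNIV UNIV (TA \<times> TB) (local_processing \<Phi> \<Psi> \<rho>T))
      \<and>
      cond_mutual_info UNIV UNIV (YS \<times> ZS)
           (local_processing (meas_channel MA) (meas_channel MB) \<rho>YZ)
         = cond_mutual_info UNIV UNIV (TA \<times> TB)
           (local_processing (meas_channel MA) (meas_channel MB) \<rho>T)
      \<and>
      card TA = (mA + CARD('y) - 1) choose (CARD('y) - 1) \<and>
      card TA \<le> (mA + 1) ^ (CARD('y) - 1) \<and>
      card TB = (mB + CARD('z) - 1) choose (CARD('z) - 1) \<and>
      card TB \<le> (mB + 1) ^ (CARD('z) - 1)"
proof -
  interpret measured_invariant_state n mA mB \<rho> MA MB
    by unfold_locales (fact n mA mB rho invA invB MA MB)+
  \<comment> \<open>Both strings vary at once here; each half of the symmetry claim keeps one of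
    them fixed.\<close>
  have same: "pr y z = pr y' z' \<and> (0 < pr y z \<longrightarrow> \<rho>A y z = \<rho>A y' z' \<and> \<rho>B y z = \<rho>B y' z')"
    if "y \<in> YS" "y' \<in> YS" "type_of_string mA y = type_of_string mA y'"
      "z \<in> ZS" "z' \<in> ZS" "type_of_string mB z = type_of_string mB z'" for y y' z z'
  proof -
    note b = br_same_type[OF that[unfolded YS_def ZS_def]]
    show ?thesis using pr_cong[OF b] cs_cong[OF b] by (simp add: pr_def \<rho>A_def \<rho>B_def)
  qed
  \<comment> \<open>The output types are generalised, since the statement is used for channels into
    \<open>'c\<close> and \<open>'d\<close> and for measurements into \<open>'y\<close> and
    \<open>'z\<close>.\<close>
  have processed: "cond_mutual_info UNIV UNIV (YS \<times> ZS) (local_processing \<Phi> \<Psi> \<rho>YZ)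
      = cond_mutual_info UNIV UNIV (TA \<times> TB) (local_processing \<Phi> \<Psi> \<rho>T)"
    if "homogeneous \<Phi>" "homogeneous \<Psi>"
    for \<Phi> :: "'a op \<Rightarrow> 'e::finite op" and \<Psi> :: "'b op \<Rightarrow> 'f::finite op"
    using cond_mutual_info_types[OF homogeneous_local[OF that]]
    by (simp add: local_processing_def YS_def ZS_def \<rho>YZ_def \<rho>T_def TA_def TB_def)
  \<comment> \<open>The case of the identity map, which is homogeneous and leaves the joint state as
    it is.\<close>
  have unprocessed: "cond_mutual_info UNIV UNIV (YS \<times> ZS) \<rho>YZ = cond_mutual_info UNIV UNIV (TA \<times> TB) \<rho>T"
    using cond_mutual_info_types[of "\<lambda>X. X"]
    by (simp add: homogeneous_def on_fst_id YS_def ZS_def \<rho>YZ_def \<rho>T_def TA_def TB_def)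
  have decomposition: "reduced_first n \<rho> = (\<lambda>i j. \<Sum>y\<in>YS. \<Sum>z\<in>ZS. of_real (pr y z) * \<rho>AB y z i j)"
    using reduced_first_decomposition by (simp add: YS_def ZS_def pr_def \<rho>AB_def)
  show ?thesis
  proof (intro conjI)
    show "reduced_first n \<rho> = (\<lambda>i j. \<Sum>y\<in>YS. \<Sum>z\<in>ZS. of_real (pr y z) * \<rho>AB y z i j)"
      by (rule decomposition)
    show "\<exists>p \<rho>At \<rho>Bt.
         (\<forall>s\<in>TA. \<forall>t\<in>TB. 0 \<le> p s t) \<and> (\<Sum>s\<in>TA. \<Sum>t\<in>TB. p s t) = 1 \<and>
         (\<forall>s\<in>TA. \<forall>t\<in>TB. state UNIV (\<rho>At s t) \<and> state UNIV (\<rho>Bt s t)) \<and>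
         (\<lambda>i j. \<Sum>y\<in>YS. \<Sum>z\<in>ZS. of_real (pr y z) * tensor (\<rho>A y z) (\<rho>B y z) i j)
           = (\<lambda>i j. \<Sum>s\<in>TA. \<Sum>t\<in>TB. of_real (p s t) * tensor (\<rho>At s t) (\<rho>Bt s t) i j) \<and>
         (\<forall>s\<in>TA. \<forall>t\<in>TB.
            p s t = outcome_prob n mA mB (type_povm mA MA) (type_povm mB MB) \<rho> s t \<and>
            p s t = (\<Sum>y\<in>strings_of_type mA s. \<Sum>z\<in>strings_of_type mB t. pr y z) \<and>
            (\<forall>y\<in>strings_of_type mA s. \<forall>z\<in>strings_of_type mB t.
               p s t = fact mA / (\<Prod>a\<in>UNIV. fact (s a)) * (fact mB / (\<Prod>b\<in>UNIV. fact (t b)))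
                       * pr y z))"
      unfolding YS_def ZS_def TA_def TB_def pr_def \<rho>A_def \<rho>B_def by (rule type_decomposition)
    show "povm (strings (blk mA)) TA (type_povm mA MA)" "povm (strings (blk mB)) TB (type_povm mB MB)"
      unfolding TA_def TB_def by (rule povm_type_povm[OF MA], rule povm_type_povm[OF MB])
    show "\<forall>(\<Phi> :: 'a op \<Rightarrow> 'c::finite op) (\<Psi> :: 'b op \<Rightarrow> 'd::finite op).
         channel \<Phi> \<and> channel \<Psi> \<longrightarrow>
         cond_mutual_info UNIV UNIV (YS \<times> ZS) (local_processing \<Phi> \<Psi> \<rho>YZ)
           = cond_mutual_info UNIV UNIV (TA \<times> TB) (local_processing \<Phi> \<Psi> \<rho>T)"
      by (intro allI impI processed homogeneous_channel; elim conjE)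
    show "card TA = (mA + CARD('y) - 1) choose (CARD('y) - 1)" "card TA \<le> (mA + 1) ^ (CARD('y) - 1)"
      "card TB = (mB + CARD('z) - 1) choose (CARD('z) - 1)" "card TB \<le> (mB + 1) ^ (CARD('z) - 1)"
      unfolding TA_def TB_def by (rule card_types card_types_le)+
    show "\<forall>y\<in>YS. \<forall>y'\<in>YS. type_of_string mA y = type_of_string mA y' \<longrightarrow>
         (\<forall>z\<in>ZS. pr y z = pr y' z \<and>
            (0 < pr y z \<longrightarrow> \<rho>A y z = \<rho>A y' z \<and> \<rho>B y z = \<rho>B y' z))"
      "\<forall>z\<in>ZS. \<forall>z'\<in>ZS. type_of_string mB z = type_of_string mB z' \<longrightarrow>
         (\<forall>y\<in>YS. pr y z = pr y z' \<and>
            (0 < pr y z \<longrightarrow> \<rho>A y z = \<rho>A y z' \<and> \<rho>B y z = \<rho>B y z'))"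
      by (intro ballI impI same refl; assumption)+
  qed (rule unprocessed processed[OF homogeneous_meas_channel homogeneous_meas_channel])+
qed

end
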